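(* Let $G=(V,E)$ be a planar graph of girth at least $8$. Then a set $E'\subseteq E$ with $|E'|=3$ such that $\gamma(G-E')>\gamma(G)$ can be found in polynomial time.
   Context: All graphs are finite, simple and undirected. A set $S\subseteq V(G)$ is a dominating set of a graph $G$ if every vertex of $G$ is in $S$ or is adjacent to an element of $S$; $\gamma(G)$ denotes the minimum cardinality of a dominating set of $G$. For $E'\subseteq E$, $G-E'=(V,E\setminus E')$. The girth of $G$ is the minimum length of an induced cycle of $G$, and is $+\infty$ if $G$ is acyclic.
   Formalization: A set E' of three edges is claimed only when G has at least 3 edges, since otherwise no such E' exists (e.g. a single vertex); polynomial-time halting is still proved for every such G. Vertices are taken to be natural numbers. *)

theory Defs
  imports "HOL-Analysis.Analysis" "HOL-Computational_Algebra.Polynomial" "HOL-Library.Extended_Nat"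
begin

definition simple_graph :: "'a set \<Rightarrow> 'a set set \<Rightarrow> bool" where
  "simple_graph V E \<longleftrightarrow> finite V \<and> (\<forall>e\<in>E. e \<subseteq> V \<and> card e = 2)"

definition dominating :: "'a set \<Rightarrow> 'a set set \<Rightarrow> 'a set \<Rightarrow> bool" where
  "dominating V E S \<longleftrightarrow> S \<subseteq> V \<and> (\<forall>v\<in>V. v \<in> S \<or> (\<exists>u\<in>S. {u, v} \<in> E))"

definition domination_number :: "'a set \<Rightarrow> 'a set set \<Rightarrow> nat" where
  "domination_number V E = Min {card S |S. dominating V E S}"

definition cycle_edges :: "'a list \<Rightarrow> 'a set set" where
  "cycle_edges c = {{c ! i, c ! (Suc i mod length c)} |i. i < length c}"

definition induced_cycle :: "'a set \<Rightarrow> 'a set set \<Rightarrow> 'a list \<Rightarrow> bool" where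
  "induced_cycle V E c \<longleftrightarrow> length c \<ge> 3 \<and> distinct c \<and> set c \<subseteq> V
     \<and> {e \<in> E. e \<subseteq> set c} = cycle_edges c"

text \<open>For an acyclic graph the infimum is over the empty set, hence \<open>\<infinity>\<close>.\<close>

definition girth :: "'a set \<Rightarrow> 'a set set \<Rightarrow> enat" where
  "girth V E = (INF c\<in>{c. induced_cycle V E c}. enat (length c))"

text \<open>The plane is \<^typ>\<open>complex\<close>, in which the library states the Jordan curve theorem.  Vertices are
  drawn as distinct points and edges as simple arcs joining their ends; an edge passes through no
  other vertex, and two edges meet at most in vertices.\<close>

definition plane_drawing ::
    "'a set \<Rightarrow> 'a set set \<Rightarrow> ('a \<Rightarrow> complex) \<Rightarrow> ('a set \<Rightarrow> real \<Rightarrow> complex) \<Rightarrow> bool" where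
  "plane_drawing V E pt curve \<longleftrightarrow>
     inj_on pt V
   \<and> (\<forall>e\<in>E. arc (curve e) \<and> {pathstart (curve e), pathfinish (curve e)} = pt ` e
            \<and> path_image (curve e) \<inter> pt ` V = pt ` e)
   \<and> (\<forall>e\<in>E. \<forall>f\<in>E. e \<noteq> f \<longrightarrow> path_image (curve e) \<inter> path_image (curve f) \<subseteq> pt ` V)"

definition planar :: "'a set \<Rightarrow> 'a set set \<Rightarrow> bool" where
  "planar V E \<longleftrightarrow> (\<exists>pt curve. plane_drawing V E pt curve)"

text \<open>Structured programs for a random access machine with registers and an indirectly addressed
  memory, both holding natural numbers.  Every elementary operation and every test costs one step.
  There is no multiplication, so apart from loading a constant of the program one step lengthens the
  largest number present by at most one bit; unit-cost time on this machine is therefore polynomially related to Turing machine time.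
  Subtraction is truncated.\<close>

record state =
  reg :: "nat \<Rightarrow> nat"
  mem :: "nat \<Rightarrow> nat"

datatype prog =
    Skip
  | Const nat nat
  | Move nat nat
  | Add nat nat nat
  | Sub nat nat nat
  | Load nat nat
  | Store nat nat
  | Seq prog prog
  | IfPos nat prog prog
  | WhilePos nat prog

abbreviation set_reg :: "nat \<Rightarrow> nat \<Rightarrow> state \<Rightarrow> state" where
  "set_reg r x s \<equiv> s\<lparr>reg := (reg s)(r := x)\<rparr>"

text \<open>\<open>run P s t s'\<close>: started in \<open>s\<close>, program \<open>P\<close> halts after exactly \<open>t\<close> steps in \<open>s'\<close>.\<close>

inductive run :: "prog \<Rightarrow> state \<Rightarrow> nat \<Rightarrow> state \<Rightarrow> bool" where
  Skip: "run Skip s 1 s"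
| Const: "run (Const r k) s 1 (set_reg r k s)"
| Move: "run (Move r a) s 1 (set_reg r (reg s a) s)"
| Add: "run (Add r a b) s 1 (set_reg r (reg s a + reg s b) s)"
| Sub: "run (Sub r a b) s 1 (set_reg r (reg s a - reg s b) s)"
| Load: "run (Load r a) s 1 (set_reg r (mem s (reg s a)) s)"
| Store: "run (Store a r) s 1 (s\<lparr>mem := (mem s)(reg s a := reg s r)\<rparr>)"
| Seq: "run P s t s' \<Longrightarrow> run Q s' u s'' \<Longrightarrow> run (Seq P Q) s (t + u) s''"
| If_pos: "reg s r > 0 \<Longrightarrow> run P s t s' \<Longrightarrow> run (IfPos r P Q) s (Suc t) s'"
| If_zero: "reg s r = 0 \<Longrightarrow> run Q s t s' \<Longrightarrow> run (IfPos r P Q) s (Suc t) s'"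
| While_zero: "reg s r = 0 \<Longrightarrow> run (WhilePos r P) s 1 s"
| While_pos: "reg s r > 0 \<Longrightarrow> run P s t s' \<Longrightarrow> run (WhilePos r P) s' u s''
    \<Longrightarrow> run (WhilePos r P) s (Suc (t + u)) s''"

lemma run_deterministic:
  assumes "run P s t s'" and "run P s u s''"
  shows "u = t \<and> s'' = s'"
  using assms
proof (induction arbitrary: u s'' rule: run.induct)
  case (Seq P s t s1 Q v s2)
  from Seq.prems show ?case
    by (cases rule: run.cases) (auto dest!: Seq.IH)
next
  case (If_pos s r P t s1 Q)
  from If_pos.prems If_pos.hyps show ?case
    by (cases rule: run.cases) (auto dest!: If_pos.IH)
next
  case (If_zero s r Q t s1 P)
  from If_zero.prems If_zero.hyps show ?case
    by (cases rule: run.cases) (auto dest!: If_zero.IH)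
next
  case (While_zero s r P)
  from While_zero.prems While_zero.hyps show ?case
    by (cases rule: run.cases) auto
next
  case (While_pos s r P t s1 v s2)
  from While_pos.prems While_pos.hyps show ?case
    by (cases rule: run.cases) (auto dest!: While_pos.IH)
qed (erule run.cases; simp)+

text \<open>A graph is presented to the machine by numbering its vertices, \<open>vs\<close> being a repetition-free
  listing of them: register 0 holds the number of vertices, and the memory holds the adjacency
  matrix row by row.  Everything else is 0.\<close>

definition graph_input :: "'a list \<Rightarrow> 'a set set \<Rightarrow> state" where
  "graph_input vs E = (let n = length vs in
     \<lparr>reg = (\<lambda>_. 0)(0 := n),
      mem = (\<lambda>a. if a < n * n \<and> {vs ! (a div n), vs ! (a mod n)} \<in> E then 1 else 0)\<rparr>)"

text \<open>A set of edges is output as a list of pairs of vertex numbers: register 0 holds the length of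
  the list, and the pairs occupy the memory from address 0 on.\<close>

definition edges_output :: "'a list \<Rightarrow> state \<Rightarrow> 'a set set \<Rightarrow> bool" where
  "edges_output vs s F \<longleftrightarrow>
     (\<forall>a < 2 * reg s 0. mem s a < length vs)
   \<and> F = {{vs ! mem s (2 * i), vs ! mem s (2 * i + 1)} |i. i < reg s 0}"

end

theory Submission
  imports Defs
begin

text \<open>Let \<open>u\<close> and \<open>v\<close> be distinct vertices at distance at most two with \<open>d(u) + d(v) \<le> 4\<close>. Some
  set of \<open>d(u) + d(v) - 1\<close> edges at \<open>u\<close> and \<open>v\<close> isolates \<open>v\<close> and leaves \<open>u\<close> isolated as well or
  with the common neighbour as its only neighbour. After its removal a minimum dominating set
  spends a vertex on \<open>v\<close> alone, which it can save in the original graph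
  (\<open>cut_off_increases_domination\<close>). Removing still more edges does no harm, so every graph with
  such a pair and with at least three edges has three edges as required.

  A planar graph of girth at least 8 that has an edge has such a pair
  (\<open>near_pair_of_small_degree\<close>). Without one, the vertices of degree at least 2 would induce a
  graph of average degree at least 8/3. But in a planar graph whose cycles all have length at
  least 8 we have \<open>3 |E| < 4 |V|\<close> (\<open>card_edges_less\<close>). This is Euler's formula with face lengths
  at least 8, and it is derived from the Jordan curve theorem and from Janiszewski's theorem: an
  edge between vertices that are already joined splits a face, so there are at least \<open>|E| - |V|
  + 2\<close> faces (\<open>many_faces\<close>); every face has a cycle on its border if there are two faces
  (\<open>border_contains_cycle\<close>); and an edge on a cycle borders at most two faces
  (\<open>closing_edge_two_faces\<close>).

  The machine need not know why three such edges exist. That they cut off a pair is a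
  first-order property of their six ends, and for a fixed first-order formula all assignments of
  its variables can be tried in polynomial time (\<open>searches_loop\<close>).\<close>

section \<open>Cycles\<close>

definition reachable :: "'a set set \<Rightarrow> 'a \<Rightarrow> 'a \<Rightarrow> bool" where
  "reachable F = (\<lambda>u v. {u, v} \<in> F)\<^sup>*\<^sup>*"

lemma reachable_refl: "reachable F u u"
  by (simp add: reachable_def)

lemma reachable_step: "reachable F u v \<Longrightarrow> {v, w} \<in> F \<Longrightarrow> reachable F u w"
  unfolding reachable_def by (rule rtranclp.rtrancl_into_rtrancl)

lemma reachable_mono: "reachable F u v \<Longrightarrow> F \<subseteq> G \<Longrightarrow> reachable G u v"
  unfolding reachable_def by (erule rtranclp_mono[THEN predicate2D, rotated]) blast

definition cycle_in :: "'a set set \<Rightarrow> 'a list \<Rightarrow> bool" where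
  "cycle_in E c \<longleftrightarrow> length c \<ge> 3 \<and> distinct c \<and> cycle_edges c \<subseteq> E"

lemma reachable_imp_simple_path:
  assumes "reachable F a b"
  obtains xs where "xs \<noteq> []" "distinct xs" "hd xs = a" "last xs = b"
    "\<And>i. Suc i < length xs \<Longrightarrow> {xs ! i, xs ! Suc i} \<in> F"
proof -
  have "\<exists>xs. xs \<noteq> [] \<and> distinct xs \<and> hd xs = a \<and> last xs = b
      \<and> (\<forall>i. Suc i < length xs \<longrightarrow> {xs ! i, xs ! Suc i} \<in> F)"
    using assms unfolding reachable_def
  proof (induction rule: rtranclp_induct)
    case base
    show ?case by (rule exI[of _ "[a]"]) auto
  next
    case (step y z)
    then obtain xs where xs: "xs \<noteq> []" "distinct xs" "hd xs = a" "last xs = y"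
      "\<And>i. Suc i < length xs \<Longrightarrow> {xs ! i, xs ! Suc i} \<in> F" by blast
    show ?case
    proof (cases "z \<in> set xs")
      case True
      then obtain k where k: "k < length xs" "xs ! k = z"
        by (auto simp: in_set_conv_nth)
      have "last (take (Suc k) xs) = z"
        using k by (simp add: take_Suc_conv_app_nth)
      moreover have "hd (take (Suc k) xs) = a" "take (Suc k) xs \<noteq> []"
        using xs by (auto simp: hd_take)
      ultimately show ?thesis using xs
        by (intro exI[of _ "take (Suc k) xs"]) auto
    next
      case False
      have "{(xs @ [z]) ! i, (xs @ [z]) ! Suc i} \<in> F" if "Suc i < length (xs @ [z])" for i
      proof (cases "Suc i < length xs")
        case True
        then show ?thesis using xs(5) by (simp add: nth_append)
      next
        case False
        then have i: "i = length xs - 1" "Suc i = length xs" using that xs(1) by auto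
        have "xs ! i = y" using xs(1,4) i by (simp add: last_conv_nth)
        then show ?thesis using step(2) i by (simp add: nth_append)
      qed
      then show ?thesis using xs False
        by (intro exI[of _ "xs @ [z]"]) auto
    qed
  qed
  then show ?thesis using that by blast
qed

lemma non_bridge_imp_cycle:
  assumes "{a, b} \<in> F" "a \<noteq> b" "reachable (F - {{a, b}}) a b"
  obtains c where "cycle_in F c"
proof -
  obtain xs where xs: "xs \<noteq> []" "distinct xs" "hd xs = a" "last xs = b"
    "\<And>i. Suc i < length xs \<Longrightarrow> {xs ! i, xs ! Suc i} \<in> F - {{a, b}}"
    using reachable_imp_simple_path[OF assms(3)] by blast
  have ends: "xs ! 0 = a" "xs ! (length xs - 1) = b"
    using xs by (simp_all add: hd_conv_nth last_conv_nth)
  have "length xs \<noteq> 0" "length xs \<noteq> 1" using xs assms(2) ends by auto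
  moreover have "length xs \<noteq> 2"
  proof
    assume "length xs = 2"
    then show False using xs(5)[of 0] ends by simp
  qed
  ultimately have len: "length xs \<ge> 3" by linarith
  have "{xs ! i, xs ! (Suc i mod length xs)} \<in> F" if "i < length xs" for i
  proof (cases "Suc i < length xs")
    case True
    then show ?thesis using xs(5)[of i] by simp
  next
    case False
    then have "i = length xs - 1" "Suc i = length xs" using that by auto
    then show ?thesis using ends assms(1) by (simp add: insert_commute)
  qed
  then have "cycle_in F xs" using len xs(2) by (auto simp: cycle_in_def cycle_edges_def)
  then show ?thesis by (rule that)
qed

lemma length_cycle_le_card:
  assumes "cycle_in F c" "finite F"
  shows "length c \<le> card F"
proof -
  let ?n = "length c"
  let ?e = "\<lambda>i. {c ! i, c ! (Suc i mod ?n)}"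
  have n: "?n \<ge> 3" and d: "distinct c" and sub: "cycle_edges c \<subseteq> F"
    using assms(1) by (auto simp: cycle_in_def)
  have "inj_on ?e {..<?n}"
  proof (rule inj_onI)
    fix i j assume i: "i \<in> {..<?n}" and j: "j \<in> {..<?n}" and eq: "?e i = ?e j"
    show "i = j"
    proof (rule ccontr)
      assume "i \<noteq> j"
      moreover have "Suc k mod ?n < ?n" for k using n by (intro mod_less_divisor) linarith
      ultimately have ij: "i = Suc j mod ?n" "j = Suc i mod ?n"
        using eq d i j by (auto simp: doubleton_eq_iff nth_eq_iff_index_eq)
      have succ: "Suc k mod ?n = (if Suc k = ?n then 0 else Suc k)" if "k < ?n" for k
        using that by simp
      have "i = 0 \<and> Suc j = ?n \<or> i = Suc j" "j = 0 \<and> Suc i = ?n \<or> j = Suc i"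
        using ij succ i j by (metis lessThan_iff)+
      then show False using n by linarith
    qed
  qed
  then have "card (?e ` {..<?n}) = ?n" by (simp add: card_image)
  moreover have "?e ` {..<?n} \<subseteq> F" using sub by (auto simp: cycle_edges_def)
  ultimately show ?thesis using card_mono[OF assms(2)] by metis
qed

text \<open>A shortest cycle has no chord, for a chord would cut off a shorter cycle. So the girth,
  which looks at induced cycles only, bounds the length of every cycle.\<close>

lemma cycle_imp_induced_cycle:
  assumes "simple_graph V E" "cycle_in E c"
  shows "\<exists>d. induced_cycle V E d \<and> length d \<le> length c"
  using assms(2)
proof (induction "length c" arbitrary: c rule: less_induct)
  case less
  let ?n = "length c"
  have n: "?n \<ge> 3" and d: "distinct c" and sub: "cycle_edges c \<subseteq> E"
    using less.prems by (auto simp: cycle_in_def)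
  have mem: "set c \<subseteq> V"
  proof
    fix v assume "v \<in> set c"
    then obtain i where "i < ?n" "c ! i = v" by (auto simp: in_set_conv_nth)
    then have "{v, c ! (Suc i mod ?n)} \<in> E" using sub by (auto simp: cycle_edges_def)
    then show "v \<in> V" using assms(1) by (auto simp: simple_graph_def)
  qed
  have cyc_sub: "cycle_edges c \<subseteq> {e \<in> E. e \<subseteq> set c}"
  proof
    fix e assume e: "e \<in> cycle_edges c"
    then obtain i where i: "i < ?n" "e = {c ! i, c ! (Suc i mod ?n)}"
      by (auto simp: cycle_edges_def)
    have "Suc i mod ?n < ?n" using n by (intro mod_less_divisor) linarith
    then show "e \<in> {e \<in> E. e \<subseteq> set c}" using i e sub by auto
  qed
  show ?case
  proof (cases "{e \<in> E. e \<subseteq> set c} = cycle_edges c")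
    case True
    then have "induced_cycle V E c" using n d mem by (simp add: induced_cycle_def)
    then show ?thesis by blast
  next
    case False
    then obtain e where e: "e \<in> E" "e \<subseteq> set c" "e \<notin> cycle_edges c" using cyc_sub by blast
    have "card e = 2" using e assms(1) by (auto simp: simple_graph_def)
    then obtain u v where uv: "e = {u, v}" "u \<noteq> v" by (auto simp: card_2_iff)
    obtain i' j' where ij': "i' < ?n" "j' < ?n" "c ! i' = u" "c ! j' = v"
      using e uv by (auto simp: in_set_conv_nth)
    then obtain i j where ij: "i < j" "j < ?n" "e = {c ! i, c ! j}"
    proof (cases "i' < j'")
      case True
      then show ?thesis using that[of i' j'] uv ij' by simp
    next
      case False
      then have "j' < i'" using uv ij' by (metis linorder_neqE_nat)
      then show ?thesis using that[of j' i'] uv ij' by (simp add: insert_commute)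
    qed
    have "j \<noteq> Suc i"
    proof
      assume "j = Suc i"
      then have "e \<in> cycle_edges c" unfolding cycle_edges_def using ij
        by (auto intro!: exI[of _ i])
      then show False using e by simp
    qed
    moreover have "\<not> (i = 0 \<and> j = ?n - 1)"
    proof
      assume A: "i = 0 \<and> j = ?n - 1"
      then have "Suc j = ?n" using n by simp
      then have "Suc j mod ?n = 0" by simp
      then have "e \<in> cycle_edges c" unfolding cycle_edges_def using ij A
        by (intro CollectI exI[of _ j]) (auto simp: insert_commute)
      then show False using e by simp
    qed
    ultimately have ij2: "Suc i < j" "j - i < ?n - 1" using ij by auto
    define d' where "d' = take (Suc (j - i)) (drop i c)"
    have len: "length d' = Suc (j - i)" using ij by (simp add: d'_def)
    have nth: "d' ! k = c ! (i + k)" if "k \<le> j - i" for k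
      using that ij by (simp add: d'_def)
    have "{d' ! k, d' ! (Suc k mod length d')} \<in> E" if "k < length d'" for k
    proof (cases "k = j - i")
      case True
      then have "d' ! k = c ! j" "d' ! (Suc k mod length d') = c ! i"
        using nth[of k] nth[of 0] ij len by auto
      then show ?thesis using e ij by (simp add: insert_commute)
    next
      case False
      then have k: "k < j - i" using that len by simp
      then have "{c ! (i + k), c ! (Suc (i + k) mod ?n)} \<in> cycle_edges c"
        using ij unfolding cycle_edges_def by (intro CollectI exI[of _ "i + k"]) simp
      then have "{c ! (i + k), c ! (Suc (i + k) mod ?n)} \<in> E" using sub by blast
      then show ?thesis using nth[of k] nth[of "Suc k"] k len ij by simp
    qed
    then have "cycle_in E d'"
      using len ij2 d by (auto simp: cycle_in_def cycle_edges_def d'_def)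
    moreover have "length d' < ?n" using len ij2 by simp
    ultimately show ?thesis using less.hyps[of d'] by fastforce
  qed
qed

lemma girth_le_length_cycle:
  assumes "simple_graph V E" "cycle_in E c"
  shows "girth V E \<le> enat (length c)"
proof -
  obtain d where "induced_cycle V E d" "length d \<le> length c"
    using cycle_imp_induced_cycle[OF assms] by blast
  then have "girth V E \<le> enat (length d)" unfolding girth_def by (intro INF_lower) simp
  then show ?thesis using \<open>length d \<le> length c\<close> by (meson enat_ord_simps(1) order_trans)
qed

section \<open>Faces of a plane drawing\<close>

lemma interior_arc_empty:
  fixes g :: "real \<Rightarrow> complex"
  assumes "arc g"
  shows "interior (path_image g) = {}"
proof -
  obtain f h where "homeomorphism (path_image g) {0..1::real} f h"
    using homeomorphic_arc_image_interval[OF assms, of 0 1] by (auto simp: homeomorphic_def)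
  then have "continuous_on (path_image g) f" "inj_on f (path_image g)"
    by (simp add: homeomorphism_def, metis homeomorphism_apply1 inj_on_inverseI)
  then have "continuous_on (interior (path_image g)) f" "inj_on f (interior (path_image g))"
    by (meson interior_subset continuous_on_subset inj_on_subset)+
  then show ?thesis
    using invariance_of_dimension[of "interior (path_image g)" f] by auto
qed

locale drawn_graph =
  fixes V :: "'a set" and E :: "'a set set"
    and pt :: "'a \<Rightarrow> complex" and curve :: "'a set \<Rightarrow> real \<Rightarrow> complex"
  assumes graph: "simple_graph V E" and drawn: "plane_drawing V E pt curve"
begin

lemma finite_V: "finite V" and finite_E: "finite E"
  using graph finite_subset[of E "Pow V"] by (auto simp: simple_graph_def)

lemma edgeE:
  assumes "e \<in> E"
  obtains a b where "e = {a, b}" "a \<noteq> b" "a \<in> V" "b \<in> V"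
    "pathstart (curve e) = pt a" "pathfinish (curve e) = pt b"
proof -
  have "card e = 2" "e \<subseteq> V" using assms graph by (auto simp: simple_graph_def)
  then obtain a b where ab: "e = {a, b}" "a \<noteq> b" "a \<in> V" "b \<in> V" by (auto simp: card_2_iff)
  have "{pathstart (curve e), pathfinish (curve e)} = {pt a, pt b}"
    using assms drawn ab by (auto simp: plane_drawing_def)
  then consider "pathstart (curve e) = pt a" "pathfinish (curve e) = pt b"
    | "pathstart (curve e) = pt b" "pathfinish (curve e) = pt a"
    by (auto simp: doubleton_eq_iff)
  then show ?thesis
    by cases (use that[of a b] that[of b a] ab in \<open>auto simp: insert_commute\<close>)
qed

lemma arc_curve: "e \<in> E \<Longrightarrow> arc (curve e)"
  and curve_Int_points: "e \<in> E \<Longrightarrow> path_image (curve e) \<inter> pt ` V = pt ` e"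
  and curve_ends: "e \<in> E \<Longrightarrow> {pathstart (curve e), pathfinish (curve e)} = pt ` e"
  and curves_Int: "e \<in> E \<Longrightarrow> f \<in> E \<Longrightarrow> e \<noteq> f \<Longrightarrow> path_image (curve e) \<inter> path_image (curve f) \<subseteq> pt ` V"
  and inj_pt: "inj_on pt V"
  using drawn by (auto simp: plane_drawing_def)

text \<open>All vertices belong to the drawing of a set of edges; so adding an edge only adds the
  interior of its curve.\<close>

definition image_of :: "'a set set \<Rightarrow> complex set" where
  "image_of F = pt ` V \<union> (\<Union>e\<in>F. path_image (curve e))"

abbreviation same_face :: "'a set set \<Rightarrow> complex \<Rightarrow> complex \<Rightarrow> bool" where
  "same_face F \<equiv> connected_component (- image_of F)"

lemma compact_points_Un_curves:
  assumes "U \<subseteq> V" "F \<subseteq> E"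
  shows "compact (pt ` U \<union> (\<Union>e\<in>F. path_image (curve e)))"
proof -
  have "finite (pt ` U)" "finite F"
    using assms finite_V finite_E finite_subset by blast+
  then show ?thesis
    using assms by (intro compact_Un compact_UN) (auto simp: compact_arc_image arc_curve finite_imp_compact)
qed

lemma compact_image_of: "F \<subseteq> E \<Longrightarrow> compact (image_of F)"
  unfolding image_of_def by (rule compact_points_Un_curves[OF order_refl])

lemma open_compl_image_of: "F \<subseteq> E \<Longrightarrow> open (- image_of F)"
  using compact_image_of compact_imp_closed by blast

lemma image_of_mono: "F \<subseteq> G \<Longrightarrow> image_of F \<subseteq> image_of G"
  by (auto simp: image_of_def)

lemma image_of_insert: "image_of (insert e F) = path_image (curve e) \<union> image_of F"
  by (auto simp: image_of_def)

lemma same_face_antimono: "same_face G x y \<Longrightarrow> F \<subseteq> G \<Longrightarrow> same_face F x y"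
  by (erule connected_component_of_subset) (use image_of_mono in blast)

lemma curve_Int_image_of:
  assumes "e \<in> E" "F \<subseteq> E" "e \<notin> F"
  shows "path_image (curve e) \<inter> image_of F = pt ` e"
proof -
  have "path_image (curve e) \<inter> path_image (curve f) \<subseteq> pt ` V" if "f \<in> F" for f
  proof -
    have "f \<in> E" "e \<noteq> f" using that assms by auto
    then show ?thesis by (rule curves_Int[OF assms(1)])
  qed
  then have "(\<Union>f\<in>F. path_image (curve e) \<inter> path_image (curve f)) \<subseteq> path_image (curve e) \<inter> pt ` V"
    by (intro UN_least Int_greatest Int_lower1) simp
  then have "path_image (curve e) \<inter> image_of F = path_image (curve e) \<inter> pt ` V"
    unfolding image_of_def Int_Un_distrib Int_UN_distrib by (rule Un_absorb2)
  then show ?thesis by (simp only: curve_Int_points[OF assms(1)])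
qed

lemma reachable_imp_path_component:
  assumes "F \<subseteq> E" "reachable F a b" "a \<in> V"
  shows "path_component (image_of F) (pt a) (pt b)"
  using assms(2) unfolding reachable_def
proof (induction rule: rtranclp_induct)
  case base
  show ?case using assms(3) by (auto simp: path_component_refl_eq image_of_def)
next
  case (step y z)
  have e: "{y, z} \<in> E" using step assms by auto
  then have "pt y \<in> path_image (curve {y, z})" "pt z \<in> path_image (curve {y, z})"
    using curve_Int_points[of "{y, z}"] by auto
  moreover have "path_connected (path_image (curve {y, z}))"
    using e arc_curve arc_imp_path path_connected_path_image by blast
  moreover have "path_image (curve {y, z}) \<subseteq> image_of F" using step by (auto simp: image_of_def)
  ultimately have "path_component (image_of F) (pt y) (pt z)"
    by (metis path_component_of_subset path_connected_component)
  then show ?case using step path_component_trans by blast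
qed

text \<open>An arc has empty interior, so adding an edge covers no face entirely.\<close>

lemma same_face_off_edge:
  assumes "e \<in> E" "F \<subseteq> E" "x \<notin> image_of F"
  shows "\<exists>y. y \<notin> image_of (insert e F) \<and> same_face F x y"
proof -
  obtain r where r: "r > 0" "ball x r \<subseteq> - image_of F"
    using assms open_compl_image_of by (meson ComplI open_contains_ball)
  have "\<not> ball x r \<subseteq> path_image (curve e)"
    using interior_arc_empty[OF arc_curve[OF assms(1)]] r(1)
    by (metis centre_in_ball empty_iff interior_maximal open_ball subsetD)
  then obtain y where y: "y \<in> ball x r" "y \<notin> path_image (curve e)" by blast
  have "same_face F x y"
    unfolding connected_component_def using r y by (intro exI[of _ "ball x r"]) auto
  then show ?thesis using y r by (auto simp: image_of_insert)
qed

text \<open>The ends of the edge are joined by an arc within the drawing of \<open>F\<close>, whose image is \<open>A\<close>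
  below. As the edge meets this drawing in its ends only, the two form a Jordan curve.\<close>

lemma closing_edge_Jordan_curve:
  assumes e: "e = {a, b}" "e \<in> E" and F: "F \<subseteq> E" "e \<notin> F"
    and joined: "path_component (image_of F) (pt a) (pt b)"
  obtains A inner outer where
    "A \<subseteq> image_of F" "connected A" "pt ` e \<subseteq> A" "closed (path_image (curve e) \<union> A)"
    "open inner" "connected inner" "open outer" "connected outer" "inner \<inter> outer = {}"
    "inner \<union> outer = - (path_image (curve e) \<union> A)"
    "frontier inner = path_image (curve e) \<union> A" "frontier outer = path_image (curve e) \<union> A"
proof -
  let ?c = "curve e"
  have ends: "{pathstart ?c, pathfinish ?c} = pt ` e" using e curve_ends by blast
  then have ends': "{pathstart ?c, pathfinish ?c} = {pt a, pt b}" using e by auto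
  have ne: "pathfinish ?c \<noteq> pathstart ?c" using arc_distinct_ends[OF arc_curve[OF e(2)]] by simp
  have "path_component (image_of F) (pathfinish ?c) (pathstart ?c)"
    using joined ends' path_component_sym by (auto simp: doubleton_eq_iff)
  then obtain p where p: "path p" "path_image p \<subseteq> image_of F"
      "pathstart p = pathfinish ?c" "pathfinish p = pathstart ?c"
    unfolding path_component_def by auto
  obtain q where q: "arc q" "path_image q \<subseteq> path_image p" "pathstart q = pathfinish ?c"
      "pathfinish q = pathstart ?c"
    using path_contains_arc[OF p(1,3,4) ne] by blast
  have meet: "path_image ?c \<inter> path_image q \<subseteq> {pathstart ?c, pathstart q}"
  proof -
    have "path_image q \<subseteq> image_of F" using q(2) p(2) by simp
    then have "path_image ?c \<inter> path_image q \<subseteq> pt ` e"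
      using curve_Int_image_of[OF e(2) F] by blast
    then show ?thesis using ends q(3) by simp
  qed
  have sp: "simple_path (?c +++ q)"
    using simple_path_join_loop[OF arc_curve[OF e(2)] q(1)] q meet by simp
  have loop: "pathfinish (?c +++ q) = pathstart (?c +++ q)" using q by simp
  have img: "path_image (?c +++ q) = path_image ?c \<union> path_image q"
    by (rule path_image_join) (use q in simp)
  obtain inner outer where io: "inner \<noteq> {}" "open inner" "connected inner"
                "outer \<noteq> {}" "open outer" "connected outer"
                "inner \<inter> outer = {}"
                "inner \<union> outer = - path_image (?c +++ q)"
                "frontier inner = path_image (?c +++ q)"
                "frontier outer = path_image (?c +++ q)"
    using Jordan_curve[OF sp loop] by metis
  show ?thesis
  proof (rule that[of "path_image q" inner outer])
    show "path_image q \<subseteq> image_of F" using q p by simp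
    show "connected (path_image q)" using q by (simp add: connected_arc_image)
    show "pt ` e \<subseteq> path_image q"
      unfolding ends[symmetric]
      using q(3,4) pathstart_in_path_image[of q] pathfinish_in_path_image[of q] by simp
    show "closed (path_image ?c \<union> path_image q)"
      using closed_simple_path_image[OF sp] by (simp only: img)
  qed (simp_all only: io(2,3,5,6,7) io(8-10)[unfolded img])
qed

text \<open>The Jordan curve is the frontier of both its sides. So a small disc around an interior
  point of the edge, which avoids the rest of the drawing, contains points of either side.\<close>

lemma closing_edge_splits_face:
  assumes e: "e = {a, b}" "e \<in> E" and F: "F \<subseteq> E" "e \<notin> F"
    and joined: "path_component (image_of F) (pt a) (pt b)"
  shows "\<exists>p q. p \<notin> image_of (insert e F) \<and> q \<notin> image_of (insert e F)
    \<and> same_face F p q \<and> \<not> same_face (insert e F) p q"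
proof -
  obtain A inner outer where A: "A \<subseteq> image_of F" "connected A" "pt ` e \<subseteq> A"
        "closed (path_image (curve e) \<union> A)"
      and io: "open inner" "connected inner" "open outer" "connected outer" "inner \<inter> outer = {}"
        "inner \<union> outer = - (path_image (curve e) \<union> A)"
        "frontier inner = path_image (curve e) \<union> A" "frontier outer = path_image (curve e) \<union> A"
    by (rule closing_edge_Jordan_curve[OF assms])
  have near: "\<exists>y \<in> D. y \<notin> image_of (insert e F) \<and> same_face F x y"
    if x: "x \<in> path_image (curve e)" "x \<notin> image_of F" and D: "D = inner \<or> D = outer" for x D
  proof -
    obtain r where r: "r > 0" "ball x r \<subseteq> - image_of F"
      using x open_compl_image_of[OF F(1)] by (meson ComplI open_contains_ball)
    have "x \<in> closure D" using x io D frontier_def by blast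
    then obtain y where y: "y \<in> D" "y \<in> ball x r"
      using r by (metis closure_approachable dist_commute mem_ball)
    have "y \<notin> path_image (curve e)" using y D io by blast
    moreover have "y \<notin> image_of F" using y r by blast
    moreover have "same_face F x y"
      unfolding connected_component_def
      using r y by (intro exI[of _ "ball x r"]) auto
    ultimately show ?thesis using y by (auto simp: image_of_insert)
  qed
  have "path_image (curve e) - {pathstart (curve e), pathfinish (curve e)} \<noteq> {}"
    using e arc_curve arc_imp_simple_path nonempty_simple_path_endless by blast
  then obtain z where z: "z \<in> path_image (curve e)" "z \<notin> pt ` e"
    using e curve_ends by blast
  have "z \<notin> image_of F" using z curve_Int_image_of[OF e(2) F] by blast
  then obtain p q where pq: "p \<in> inner" "q \<in> outer" "p \<notin> image_of (insert e F)"
      "q \<notin> image_of (insert e F)" "same_face F z p" "same_face F z q"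
    using near[OF z(1)] by metis
  have "\<not> same_face (insert e F) p q"
  proof
    assume "same_face (insert e F) p q"
    then obtain T where T: "connected T" "T \<subseteq> - image_of (insert e F)" "p \<in> T" "q \<in> T"
      by (auto simp: connected_component_def)
    have "T \<subseteq> inner \<union> outer" using T(2) A(1) io(6) unfolding image_of_insert by blast
    then show False
      using connectedD[OF T(1) io(1,3)] T pq io(5) by blast
  qed
  moreover have "same_face F p q"
    using pq by (meson connected_component_sym connected_component_trans)
  ultimately show "\<exists>p q. p \<notin> image_of (insert e F) \<and> q \<notin> image_of (insert e F)
    \<and> same_face F p q \<and> \<not> same_face (insert e F) p q" using pq by blast
qed

text \<open>Of three points off the drawing, two lie on the same side of the Jordan curve. Neither
  this curve nor the drawing without the edge separates these two. As the two sets meet in the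
  connected set \<open>A\<close>, by Janiszewski's theorem their union does not separate them either.\<close>

lemma closing_edge_two_faces:
  assumes e: "e = {a, b}" "e \<in> E"
    and joined: "path_component (image_of (E - {e})) (pt a) (pt b)"
    and off: "x \<notin> image_of E" "y \<notin> image_of E" "z \<notin> image_of E"
    and same: "same_face (E - {e}) x y" "same_face (E - {e}) y z" "same_face (E - {e}) x z"
  shows "same_face E x y \<or> same_face E y z \<or> same_face E x z"
proof -
  have F: "E - {e} \<subseteq> E" "e \<notin> E - {e}" by auto
  obtain A inner outer where A: "A \<subseteq> image_of (E - {e})" "connected A" "pt ` e \<subseteq> A"
        "closed (path_image (curve e) \<union> A)"
      and io: "open inner" "connected inner" "open outer" "connected outer" "inner \<inter> outer = {}"
        "inner \<union> outer = - (path_image (curve e) \<union> A)"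
        "frontier inner = path_image (curve e) \<union> A" "frontier outer = path_image (curve e) \<union> A"
    by (rule closing_edge_Jordan_curve[OF e F joined])
  let ?J = "path_image (curve e) \<union> A"
  have un: "image_of (E - {e}) \<union> ?J = image_of E"
    using A(1) e image_of_insert[of e "E - {e}"] by (auto simp: insert_absorb)
  have int: "image_of (E - {e}) \<inter> ?J = A"
    using A curve_Int_image_of[OF e(2) F] by blast
  have glue: "same_face E p q"
    if "same_face (E - {e}) p q" "D = inner \<or> D = outer" "p \<in> D" "q \<in> D" for p q D
  proof -
    have "connected_component (- ?J) p q"
      unfolding connected_component_def using that(2-4) io(2,4,6) by (intro exI[of _ D]) blast
    then have "connected_component (- (image_of (E - {e}) \<union> ?J)) p q"
      using Janiszewski[OF compact_image_of[OF F(1)] A(4), unfolded int, OF A(2) that(1)] by blast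
    then show ?thesis by (simp only: un)
  qed
  have "x \<in> inner \<union> outer" "y \<in> inner \<union> outer" "z \<in> inner \<union> outer"
    using off un io(6) by auto
  then show ?thesis using glue same by blast
qed

definition image_within :: "'a set set \<Rightarrow> 'a set \<Rightarrow> complex set" where
  "image_within F U = pt ` U \<union> (\<Union>f\<in>{f \<in> F. f \<subseteq> U}. path_image (curve f))"

lemma curve_Int_points_of:
  assumes "e \<in> E" "U \<subseteq> V"
  shows "path_image (curve e) \<inter> pt ` U = pt ` (e \<inter> U)"
proof -
  have "e \<subseteq> V" using assms graph by (auto simp: simple_graph_def)
  then have "pt ` (e \<inter> U) = pt ` e \<inter> pt ` U" using inj_on_image_Int[OF inj_pt _ assms(2)] by simp
  moreover have "path_image (curve e) \<inter> pt ` U = (path_image (curve e) \<inter> pt ` V) \<inter> pt ` U"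
    using image_mono[OF assms(2), of pt] by (simp add: Int_assoc inf.absorb2)
  ultimately show ?thesis by (simp only: curve_Int_points[OF assms(1)])
qed

lemma curve_Int_image_within:
  assumes "e \<in> E" "U \<subseteq> V" "F \<subseteq> E" "e \<in> F \<Longrightarrow> \<not> e \<subseteq> U"
  shows "path_image (curve e) \<inter> image_within F U = pt ` (e \<inter> U)"
proof -
  have "path_image (curve e) \<inter> path_image (curve f) \<subseteq> pt ` U" if "f \<in> F" "f \<subseteq> U" for f
  proof -
    have f: "f \<in> E" "e \<noteq> f" using that assms by auto
    then have "path_image (curve e) \<inter> path_image (curve f) \<subseteq> path_image (curve f) \<inter> pt ` V"
      using curves_Int[OF assms(1) f] by blast
    also have "\<dots> = pt ` f" by (rule curve_Int_points[OF f(1)])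
    finally show ?thesis using that by blast
  qed
  then have "(\<Union>f\<in>{f \<in> F. f \<subseteq> U}. path_image (curve e) \<inter> path_image (curve f))
      \<subseteq> path_image (curve e) \<inter> pt ` U"
    by (intro UN_least Int_greatest Int_lower1) simp
  then have "path_image (curve e) \<inter> image_within F U = path_image (curve e) \<inter> pt ` U"
    unfolding image_within_def Int_Un_distrib Int_UN_distrib by (rule Un_absorb2)
  then show ?thesis using curve_Int_points_of[OF assms(1,2)] by simp
qed

lemma image_within_disjoint:
  assumes "F \<subseteq> E" "U \<subseteq> V" "W \<subseteq> V" "U \<inter> W = {}"
  shows "image_within F U \<inter> image_within F W = {}"
proof -
  have "pt ` U \<inter> pt ` W = {}"
    using inj_on_image_Int[OF inj_pt assms(2,3)] assms(4) by simp
  moreover have "pt ` U \<inter> path_image (curve g) = {}" if "g \<in> F" "g \<subseteq> W" for g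
  proof -
    have "g \<in> E" "g \<inter> U = {}" using that assms by blast+
    then show ?thesis using curve_Int_points_of[of g U] assms(2) by (simp add: Int_commute)
  qed
  ultimately have 1: "pt ` U \<inter> image_within F W = {}"
    unfolding image_within_def Int_Un_distrib Int_UN_distrib Un_empty UNION_empty_conv(1) by simp
  have "path_image (curve f) \<inter> image_within F W = {}" if "f \<in> F" "f \<subseteq> U" for f
  proof -
    have fE: "f \<in> E" using that assms(1) by blast
    have "f \<noteq> {}" using edgeE[OF fE] by blast
    then have "\<not> f \<subseteq> W" "f \<inter> W = {}" using that assms(4) by auto
    then show ?thesis using curve_Int_image_within[OF fE assms(3,1)] by simp
  qed
  then have "image_within F W \<inter> image_within F U = {}"
    using 1 unfolding image_within_def[of F U] Int_Un_distrib Int_UN_distrib Un_empty UNION_empty_conv(1)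
    by (simp add: Int_commute)
  then show ?thesis by (simp add: Int_commute)
qed

text \<open>Were the edge a bridge, the drawing would consist of the part reachable from one end, the
  edge, and the rest. None of the three separates the points, and each meets the next in a
  single point; so by two applications of Janiszewski's theorem the whole would not separate
  them.\<close>

lemma separating_edge_non_bridge:
  assumes F: "F \<subseteq> E" and e: "e = {a, b}" "e \<in> F"
    and off: "x \<notin> image_of F" "y \<notin> image_of F"
    and same: "same_face (F - {e}) x y" and sep: "\<not> same_face F x y"
  shows "reachable (F - {e}) a b"
proof (rule ccontr)
  assume nr: "\<not> reachable (F - {e}) a b"
  define R where "R = {v \<in> V. reachable (F - {e}) a v}"
  let ?part = "image_within (F - {e})"
  have RV: "R \<subseteq> V" by (auto simp: R_def)
  have eE: "e \<in> E" and FE: "F - {e} \<subseteq> E" using F e by auto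
  have abV: "a \<in> V" "b \<in> V" using eE e graph by (auto simp: simple_graph_def)
  have compact_part: "compact (?part U)" if "U \<subseteq> V" for U
    unfolding image_within_def by (rule compact_points_Un_curves[OF that]) (use F in blast)
  have un: "?part R \<union> ?part (V - R) = image_of (F - {e})"
  proof
    show "?part R \<union> ?part (V - R) \<subseteq> image_of (F - {e})"
      using RV unfolding image_within_def image_of_def by blast
    have "f \<subseteq> R \<or> f \<subseteq> V - R" if f: "f \<in> F - {e}" for f
    proof -
      have "f \<in> E" using f F by blast
      then obtain u v where uv: "f = {u, v}" "u \<in> V" "v \<in> V" by (metis edgeE)
      have "{u, v} \<in> F - {e}" "{v, u} \<in> F - {e}" using f uv(1) by (simp_all add: insert_commute)
      then have "reachable (F - {e}) a u \<longleftrightarrow> reachable (F - {e}) a v"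
        by (meson reachable_step)
      then show ?thesis using uv by (auto simp: R_def)
    qed
    then have "path_image (curve f) \<subseteq> ?part R \<union> ?part (V - R)" if "f \<in> F - {e}" for f
      using that unfolding image_within_def by blast
    moreover have "pt ` V \<subseteq> ?part R \<union> ?part (V - R)"
      unfolding image_within_def using RV by blast
    ultimately show "image_of (F - {e}) \<subseteq> ?part R \<union> ?part (V - R)"
      unfolding image_of_def by blast
  qed
  have e_part: "path_image (curve e) \<inter> ?part U = pt ` (e \<inter> U)" if "U \<subseteq> V" for U
    by (rule curve_Int_image_within[OF eE that FE]) simp
  have disj: "?part R \<inter> ?part (V - R) = {}"
    by (rule image_within_disjoint[OF FE]) (use RV in auto)
  have aR: "a \<in> R" and bR: "b \<notin> R" using abV nr reachable_refl by (auto simp: R_def)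
  have eR: "e \<inter> R = {a}" "e \<inter> (V - R) = {b}" using aR bR abV e by auto
  have int1: "?part R \<inter> path_image (curve e) = {pt a}"
    using e_part[OF RV] eR(1) by (simp add: Int_commute)
  have int2: "(?part R \<union> path_image (curve e)) \<inter> ?part (V - R) = {pt b}"
    using e_part[of "V - R"] eR(2) disj by (simp add: Int_Un_distrib2)
  have c1: "connected_component (- ?part U) x y" if "U = R \<or> U = V - R" for U
    using same by (rule connected_component_of_subset) (use un that in blast)
  have "x \<notin> path_image (curve e)" "y \<notin> path_image (curve e)"
    using off e by (auto simp: image_of_def)
  moreover have "connected (- path_image (curve e))"
    using connected_arc_complement[OF arc_curve[OF eE]] by simp
  ultimately have c2: "connected_component (- path_image (curve e)) x y"
    unfolding connected_component_def by (intro exI[of _ "- path_image (curve e)"]) auto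
  have closed_e: "compact (path_image (curve e))" using arc_curve[OF eE] by (rule compact_arc_image)
  have "connected_component (- (?part R \<union> path_image (curve e))) x y"
    using Janiszewski[OF compact_part[OF RV] compact_imp_closed[OF closed_e], unfolded int1]
      c1[of R] c2 by simp
  then have "connected_component (- ((?part R \<union> path_image (curve e)) \<union> ?part (V - R))) x y"
    using Janiszewski[OF compact_Un[OF compact_part[OF RV] closed_e]
        compact_imp_closed[OF compact_part[of "V - R"]], unfolded int2]
      c1[of "V - R"] by simp
  moreover have "(?part R \<union> path_image (curve e)) \<union> ?part (V - R) = image_of F"
    using un image_of_insert[of e "F - {e}"] e(2) by (auto simp: insert_absorb)
  ultimately show False using sep by simp
qed

text \<open>A minimal set of edges that separates the two points needs each of its edges.\<close>

lemma minimal_separating_edges: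
  assumes F: "F \<subseteq> E" and off: "x \<notin> image_of F" "y \<notin> image_of F" and sep: "\<not> same_face F x y"
  obtains F' where "F' \<subseteq> F" "F' \<noteq> {}"
    "\<And>a b. {a, b} \<in> F' \<Longrightarrow> reachable (F' - {{a, b}}) a b"
proof -
  let ?P = "\<lambda>G. G \<subseteq> F \<and> \<not> same_face G x y"
  have "finite F" using finite_subset[OF F finite_E] .
  then have fin: "finite {G. ?P G}" by (intro finite_subset[of "{G. ?P G}" "Pow F"]) auto
  have ne: "{G. ?P G} \<noteq> {}" using sep by blast
  obtain F' where m: "F' \<in> {G. ?P G}" "\<forall>G\<in>{G. ?P G}. G \<le> F' \<longrightarrow> F' = G"
    using finite_has_minimal[OF fin ne] by (elim bexE)
  have F': "?P F'" using m(1) by simp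
  have min: "G = F'" if "?P G" "G \<subseteq> F'" for G using m(2)[rule_format, of G] that by simp
  have off': "x \<notin> image_of F'" "y \<notin> image_of F'"
    using off image_of_mono[of F' F] F' by auto
  have "F' \<noteq> {}"
  proof
    assume "F' = {}"
    then have im: "image_of F' = pt ` V" by (simp add: image_of_def)
    have "connected (- (pt ` V))"
      using connected_open_diff_countable[of "UNIV :: complex set" "pt ` V"] finite_V
      by (simp add: Compl_eq_Diff_UNIV countable_finite connected_UNIV)
    then have "same_face F' x y"
      using off' unfolding im connected_component_def by (intro exI[of _ "- pt ` V"]) auto
    then show False using F' by simp
  qed
  moreover have "reachable (F' - {{a, b}}) a b" if "{a, b} \<in> F'" for a b
  proof (rule separating_edge_non_bridge[OF _ refl that off'])
    show "F' \<subseteq> E" using conjunct1[OF F'] F by (rule order_trans)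
    show "same_face (F' - {{a, b}}) x y" using min[of "F' - {{a, b}}"] F' that by blast
    show "\<not> same_face F' x y" using F' by simp
  qed
  ultimately show ?thesis using that[of F'] F' by blast
qed

text \<open>Only interior points of the curve count: an end of the edge may well belong to the border
  of a face that the edge does not touch otherwise.\<close>

definition borders :: "'a set \<Rightarrow> complex \<Rightarrow> bool" where
  "borders e x \<longleftrightarrow> path_image (curve e) \<inter> closure {y. same_face E x y} - pt ` V \<noteq> {}"

text \<open>The frontier of the face of \<open>x\<close> consists of vertices and of points on bordering edges, and
  a connected set that leaves the face meets its frontier. So the bordering edges alone separate
  \<open>x\<close> from \<open>y\<close>.\<close>

lemma border_contains_cycle:
  assumes off: "x \<notin> image_of E" "y \<notin> image_of E" and sep: "\<not> same_face E x y"
  obtains F' where "F' \<subseteq> {e \<in> E. borders e x}" "F' \<noteq> {}"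
    "\<And>a b. {a, b} \<in> F' \<Longrightarrow> reachable (F' - {{a, b}}) a b"
proof -
  let ?B = "{e \<in> E. borders e x}" and ?C = "{y. same_face E x y}"
  have off': "x \<notin> image_of ?B" "y \<notin> image_of ?B"
    using off image_of_mono[of ?B E] by auto
  have "\<not> same_face ?B x y"
  proof
    assume "same_face ?B x y"
    then obtain D where D: "connected D" "D \<subseteq> - image_of ?B" "x \<in> D" "y \<in> D"
      by (auto simp: connected_component_def)
    have "x \<in> ?C" using off by (simp add: connected_component_refl)
    then have "D \<inter> frontier ?C \<noteq> {}" using D sep by (intro connected_Int_frontier) auto
    then obtain z where z: "z \<in> D" "z \<in> frontier ?C" by auto
    have "frontier ?C \<subseteq> frontier (- image_of E)" by (rule frontier_of_connected_component_subset)
    also have "\<dots> \<subseteq> image_of E"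
      using compact_image_of[of E] by (simp add: frontier_complement compact_imp_closed frontier_subset_closed)
    finally have zE: "z \<in> image_of E" using z by auto
    have "z \<notin> image_of ?B" using z D by auto
    then have "z \<notin> pt ` V" by (auto simp: image_of_def)
    then obtain e where e: "e \<in> E" "z \<in> path_image (curve e)" using zE by (auto simp: image_of_def)
    have "z \<in> closure ?C" using z by (auto simp: frontier_def)
    then have "borders e x" using e \<open>z \<notin> pt ` V\<close> by (auto simp: borders_def)
    then show False using e \<open>z \<notin> image_of ?B\<close> by (auto simp: image_of_def)
  qed
  then show ?thesis using minimal_separating_edges[of ?B x y] off' that by auto
qed

text \<open>The curve without its ends is connected and avoids the other edges; once the edge is
  removed, every face that it bordered runs into it.\<close>

lemma borders_same_face:
  assumes e: "e \<in> E" and b: "borders e x" "borders e y" and off: "x \<notin> image_of E" "y \<notin> image_of E"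
  shows "same_face (E - {e}) x y"
proof -
  let ?F = "E - {e}"
  let ?I = "path_image (curve e) - {pathstart (curve e), pathfinish (curve e)}"
  have I: "?I = path_image (curve e) - pt ` V"
    using curve_ends[OF e] curve_Int_points[OF e] by blast
  have IF: "?I \<subseteq> - image_of ?F"
    using curve_Int_image_of[of e ?F] e curve_ends[OF e] by auto
  have reach: "\<exists>q\<in>?I. same_face ?F x q" if b: "borders e x" for x
  proof -
    obtain q where q: "q \<in> ?I" "q \<in> closure {y. same_face E x y}"
      using b I by (auto simp: borders_def)
    obtain r where r: "r > 0" "ball q r \<subseteq> - image_of ?F"
      using q IF open_compl_image_of[of ?F] by (meson Diff_subset open_contains_ball subsetD)
    obtain z where z: "same_face E x z" "z \<in> ball q r"
      using q r by (auto simp: closure_approachable dist_commute)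
    have "same_face ?F z q"
      unfolding connected_component_def using z r by (intro exI[of _ "ball q r"]) auto
    then have "same_face ?F x q"
      using z same_face_antimono[of E x z ?F] connected_component_trans by blast
    then show ?thesis using q by blast
  qed
  obtain q q' where q: "q \<in> ?I" "same_face ?F x q" and q': "q' \<in> ?I" "same_face ?F y q'"
    using reach b by blast
  have "connected ?I" using e arc_curve arc_imp_simple_path connected_simple_path_endless by blast
  then have "same_face ?F q q'"
    unfolding connected_component_def using q q' IF by blast
  then show ?thesis using q q' by (meson connected_component_sym connected_component_trans)
qed

section \<open>Few edges in planar graphs without short cycles\<close>

text \<open>Faces are counted by points, at most one in each. This makes sense before one knows that
  the number of faces is finite.\<close>

definition face_points :: "'a set set \<Rightarrow> complex set \<Rightarrow> bool" where
  "face_points F S \<longleftrightarrow> finite S \<and> S \<inter> image_of F = {}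
     \<and> (\<forall>x\<in>S. \<forall>y\<in>S. same_face F x y \<longrightarrow> x = y)"

lemma face_points_off_edge:
  assumes S: "face_points F S" and e: "e \<in> E" "F \<subseteq> E"
  obtains S' where "face_points F S'" "card S' = card S" "S' \<inter> image_of (insert e F) = {}"
proof -
  have "\<forall>x\<in>S. \<exists>y. y \<notin> image_of (insert e F) \<and> same_face F x y"
    using S same_face_off_edge[OF e] by (auto simp: face_points_def)
  then obtain m where m: "\<And>x. x \<in> S \<Longrightarrow> m x \<notin> image_of (insert e F) \<and> same_face F x (m x)"
    by metis
  have uniq: "x = y" if "x \<in> S" "y \<in> S" "same_face F (m x) (m y)" for x y
  proof -
    have "same_face F x y"
      using m that by (meson connected_component_sym connected_component_trans)
    then show ?thesis using S that by (auto simp: face_points_def)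
  qed
  have off: "m x \<notin> image_of F" if "x \<in> S" for x
    using m[OF that] by (auto simp: image_of_insert)
  have "face_points F (m ` S)"
    using S off uniq by (auto simp: face_points_def)
  moreover have "inj_on m S"
    using uniq off by (auto simp: inj_on_def connected_component_refl)
  ultimately show ?thesis
    using that[of "m ` S"] m by (auto simp: card_image)
qed

lemma face_points_insert_edge:
  assumes "face_points F S" "S \<inter> image_of (insert e F) = {}"
  shows "face_points (insert e F) S"
  using assms same_face_antimono[OF _ subset_insertI[of F e]] by (auto simp: face_points_def)

lemma face_points_closing_edge:
  assumes S: "face_points F S" and e: "e = {a, b}" "e \<in> E" and F: "F \<subseteq> E" "e \<notin> F"
    and joined: "path_component (image_of F) (pt a) (pt b)"
  shows "\<exists>S'. face_points (insert e F) S' \<and> card S < card S'"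
proof -
  obtain p q where pq: "p \<notin> image_of (insert e F)" "q \<notin> image_of (insert e F)"
    "same_face F p q" "\<not> same_face (insert e F) p q"
    using closing_edge_splits_face[OF e F joined] by blast
  obtain S1 where S1: "face_points F S1" "card S1 = card S" "S1 \<inter> image_of (insert e F) = {}"
    using face_points_off_edge[OF S e(2) F(1)] by blast
  let ?T = "{x \<in> S1. \<not> same_face F x p}"
  have fin: "finite S1" using S1 by (simp add: face_points_def)
  have old: "same_face (insert e F) x y \<Longrightarrow> same_face F x y" for x y
    by (erule same_face_antimono) blast
  have sym: "same_face F x y \<Longrightarrow> same_face F y x" for x y by (rule connected_component_sym)
  have trans: "same_face F x y \<Longrightarrow> same_face F y z \<Longrightarrow> same_face F x z" for x y z
    by (rule connected_component_trans)
  have uniq: "x = y" if "x \<in> S1" "y \<in> S1" "same_face F x y" for x y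
    using S1 that by (auto simp: face_points_def)
  have far: "\<not> same_face F x p" "\<not> same_face F p x" "\<not> same_face F x q" "\<not> same_face F q x"
    if "x \<in> ?T" for x
    using that pq(3) sym trans by blast+
  have pq': "\<not> same_face (insert e F) q p"
    using pq(4) connected_component_sym by blast
  have "face_points (insert e F) (insert p (insert q ?T))"
    unfolding face_points_def
  proof (intro conjI ballI impI)
    show "finite (insert p (insert q ?T))" using fin by simp
    show "insert p (insert q ?T) \<inter> image_of (insert e F) = {}" using pq S1 by blast
    fix x y
    assume xy: "x \<in> insert p (insert q ?T)" "y \<in> insert p (insert q ?T)" "same_face (insert e F) x y"
    have "same_face F x y" using xy old by blast
    then show "x = y" using xy pq(4) pq' far uniq by blast
  qed
  moreover have "card S < card (insert p (insert q ?T))"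
  proof -
    have "card (S1 - ?T) \<le> Suc 0"
      using fin uniq sym trans by (subst card_le_Suc0_iff_eq) blast+
    moreover have "card S1 = card ?T + card (S1 - ?T)"
      using fin card_Diff_subset[of ?T S1] card_mono[of S1 ?T] by auto
    moreover have "same_face F p p" "same_face F q q" "same_face (insert e F) p p"
      using pq by (simp_all add: connected_component_refl image_of_insert)
    then have "p \<noteq> q" "p \<notin> ?T" "q \<notin> ?T" using pq far(1)[of p] far(3)[of q] by blast+
    ultimately show ?thesis using fin S1(2) by simp
  qed
  ultimately show ?thesis by blast
qed

text \<open>One half of Euler's formula. The edges are drawn one after the other; \<open>comp\<close> labels the
  vertices so that equal labels are joined in the drawing. A new edge either joins two labels,
  which are then identified, or it closes up and increases the number of faces.\<close>

lemma many_faces: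
  assumes "V \<noteq> {}"
  obtains S where "face_points E S" "card E + 2 \<le> card V + card S"
proof -
  have "\<exists>comp :: 'a \<Rightarrow> 'a. \<exists>S. (\<forall>u\<in>V. \<forall>v\<in>V. comp u = comp v \<longrightarrow> path_component (image_of F) (pt u) (pt v))
     \<and> face_points F S \<and> card (comp ` V) + card F + 1 \<le> card V + card S"
    if "finite F" "F \<subseteq> E" for F
    using that
  proof (induction F rule: finite_induct)
    case empty
    have "infinite (- pt ` V)"
      using finite_V by (simp add: Compl_eq_Diff_UNIV infinite_UNIV_char_0)
    then obtain x where x: "x \<notin> pt ` V" by (metis ComplD finite.emptyI equals0I)
    show ?case
      by (rule exI[of _ id], rule exI[of _ "{x}"])
         (use x in \<open>auto simp: face_points_def image_of_def path_component_refl_eq\<close>)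
  next
    case (insert e F)
    then obtain comp :: "'a \<Rightarrow> 'a" and S
      where comp: "\<And>u v. u \<in> V \<Longrightarrow> v \<in> V \<Longrightarrow> comp u = comp v \<Longrightarrow> path_component (image_of F) (pt u) (pt v)"
        and S: "face_points F S" and c: "card (comp ` V) + card F + 1 \<le> card V + card S" by (metis insert_subset)
    have eE: "e \<in> E" using insert by auto
    obtain a b where ab: "e = {a, b}" "a \<noteq> b" "a \<in> V" "b \<in> V" using edgeE[OF eE] by metis
    have up: "path_component (image_of (insert e F)) x y" if "path_component (image_of F) x y" for x y
      using that by (rule path_component_of_subset[rotated]) (auto simp: image_of_def)
    show ?case
    proof (cases "comp a = comp b")
      case True
      then have "path_component (image_of F) (pt a) (pt b)" using comp ab by blast
      then obtain S' where S': "face_points (insert e F) S'" "card S < card S'"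
        using face_points_closing_edge[OF S ab(1) eE] insert by blast
      then show ?thesis using comp up c insert(1,2)
        by (intro exI[of _ comp] exI[of _ S']) auto
    next
      case False
      define comp' where "comp' x = (if comp x = comp b then comp a else comp x)" for x
      have "reachable (insert e F) a b"
        using reachable_step[OF reachable_refl, of a b "insert e F"] ab by simp
      then have "path_component (image_of (insert e F)) (pt a) (pt b)"
        using reachable_imp_path_component[of "insert e F" a b] insert ab by blast
      then have joined: "path_component (image_of (insert e F)) (pt u) (pt v)"
        if "u \<in> V" "v \<in> V" "comp' u = comp' v" for u v
        using that up comp ab unfolding comp'_def
        by (smt (verit) path_component_sym path_component_trans)
      have "comp' ` V \<subseteq> comp ` V - {comp b}"
        using False ab by (auto simp: comp'_def)
      then have "card (comp' ` V) \<le> card (comp ` V - {comp b})" using finite_V by (intro card_mono) auto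
      also have "\<dots> = card (comp ` V) - 1" using ab finite_V by simp
      finally have "card (comp' ` V) < card (comp ` V)"
        using ab finite_V card_gt_0_iff[of "comp ` V"] by auto
      moreover have "\<exists>S'. face_points (insert e F) S' \<and> card S \<le> card S'"
        using face_points_off_edge[OF S eE] face_points_insert_edge insert
        by (metis insert_subset order_refl)
      then obtain S' where "face_points (insert e F) S'" "card S \<le> card S'" by blast
      ultimately show ?thesis using joined c insert(1,2)
        by (intro exI[of _ comp'] exI[of _ S']) auto
    qed
  qed
  then obtain comp :: "'a \<Rightarrow> 'a" and S
    where S: "face_points E S" and c: "card (comp ` V) + card E + 1 \<le> card V + card S"
    using finite_E by blast
  have "card (comp ` V) > 0" using assms finite_V by (simp add: card_gt_0_iff)
  then show ?thesis using S c that[of S] by linarith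
qed

text \<open>If there are two faces, count the incidences between faces and edges of cycles on their borders: a
  face has at least eight such edges, and each of these borders at most two faces. So \<open>4 |S| \<le> |E|\<close>, and
  this with \<open>|E| + 2 \<le> |V| + |S|\<close> gives the claim. With a single face already \<open>|E| < |V|\<close>.\<close>

lemma card_edges_less:
  assumes ne: "V \<noteq> {}" and long: "\<And>c. cycle_in E c \<Longrightarrow> 8 \<le> length c"
  shows "3 * card E < 4 * card V"
proof -
  obtain S where S: "face_points E S" "card E + 2 \<le> card V + card S"
    using many_faces[OF ne] .
  have finS: "finite S" and off: "\<And>x. x \<in> S \<Longrightarrow> x \<notin> image_of E"
    and uniq: "\<And>x y. x \<in> S \<Longrightarrow> y \<in> S \<Longrightarrow> same_face E x y \<Longrightarrow> x = y"
    using S by (auto simp: face_points_def)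
  show ?thesis
  proof (cases "card S \<le> 1")
    case True
    then show ?thesis using S(2) by linarith
  next
    case False
    have "\<forall>x\<in>S. \<exists>F'. F' \<subseteq> {e \<in> E. borders e x} \<and> F' \<noteq> {}
      \<and> (\<forall>a b. {a, b} \<in> F' \<longrightarrow> reachable (F' - {{a, b}}) a b)"
    proof
      fix x assume x: "x \<in> S"
      have "\<not> S \<subseteq> {x}" using False card_mono[of "{x}" S] by auto
      then obtain y where y: "y \<in> S" "y \<noteq> x" by blast
      then have "\<not> same_face E x y" using uniq x by blast
      from border_contains_cycle[OF off[OF x] off[OF y(1)] this]
      show "\<exists>F'. F' \<subseteq> {e \<in> E. borders e x} \<and> F' \<noteq> {}
        \<and> (\<forall>a b. {a, b} \<in> F' \<longrightarrow> reachable (F' - {{a, b}}) a b)" by metis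
    qed
    from bchoice[OF this] obtain B where "\<forall>x\<in>S. B x \<subseteq> {e \<in> E. borders e x} \<and> B x \<noteq> {}
      \<and> (\<forall>a b. {a, b} \<in> B x \<longrightarrow> reachable (B x - {{a, b}}) a b)" ..
    note BB = this[rule_format]
    have B: "\<And>x. x \<in> S \<Longrightarrow> B x \<subseteq> {e \<in> E. borders e x}" "\<And>x. x \<in> S \<Longrightarrow> B x \<noteq> {}"
      "\<And>x a b. x \<in> S \<Longrightarrow> {a, b} \<in> B x \<Longrightarrow> reachable (B x - {{a, b}}) a b"
      by (rule conjunct1[OF BB], assumption)
         (rule conjunct1[OF conjunct2[OF BB]], assumption,
          rule conjunct2[OF conjunct2[OF BB], rule_format], assumption+)
    have BE: "B x \<subseteq> E" if "x \<in> S" for x using B(1)[OF that] by auto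
    have eight: "8 \<le> card (B x)" if x: "x \<in> S" for x
    proof -
      obtain e where e: "e \<in> B x" using B(2)[OF x] by blast
      then have "e \<in> E" using BE[OF x] by blast
      then obtain a b where ab: "e = {a, b}" "a \<noteq> b" by (metis edgeE)
      obtain c where c: "cycle_in (B x) c"
        using non_bridge_imp_cycle[of a b "B x"] e ab B(3)[OF x, of a b] by auto
      then have "cycle_in E c" using BE[OF x] by (auto simp: cycle_in_def)
      moreover have "length c \<le> card (B x)"
        using length_cycle_le_card[OF c] finite_subset[OF BE[OF x] finite_E] by simp
      ultimately show ?thesis using long by fastforce
    qed
    have two: "card {x \<in> S. e \<in> B x} \<le> 2" if eE: "e \<in> E" for e
    proof (rule ccontr)
      assume "\<not> card {x \<in> S. e \<in> B x} \<le> 2"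
      then have "3 \<le> card {x \<in> S. e \<in> B x}" by simp
      then obtain T where T: "T \<subseteq> {x \<in> S. e \<in> B x}" "card T = 3"
        using obtain_subset_with_card_n by metis
      then obtain x y z where T3: "T = {x, y, z}" "x \<noteq> y" "y \<noteq> z" "x \<noteq> z"
        by (auto simp: card_3_iff)
      have xyz: "x \<in> S" "y \<in> S" "z \<in> S" "e \<in> B x" "e \<in> B y" "e \<in> B z"
        using T T3 by auto
      obtain a b where ab: "e = {a, b}" "a \<in> V" using edgeE[OF eE] by metis
      have "reachable (B x - {e}) a b" using B(3)[OF xyz(1), of a b] xyz ab by simp
      then have "reachable (E - {e}) a b"
        by (rule reachable_mono) (use BE[OF xyz(1)] in blast)
      then have joined: "path_component (image_of (E - {e})) (pt a) (pt b)"
        by (intro reachable_imp_path_component) (use ab in auto)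
      have "borders e x" "borders e y" "borders e z" using B(1) xyz by blast+
      then have "same_face (E - {e}) x y" "same_face (E - {e}) y z" "same_face (E - {e}) x z"
        using borders_same_face[OF eE] off xyz by auto
      from closing_edge_two_faces[OF ab(1) eE joined off off off this] xyz
      show False using uniq T3 by blast
    qed
    have "8 * card S \<le> (\<Sum>x\<in>S. card (B x))"
      using sum_mono[of S "\<lambda>_. 8" "\<lambda>x. card (B x)"] eight by (simp add: mult.commute)
    also have "\<dots> = (\<Sum>x\<in>S. \<Sum>e | e \<in> E \<and> e \<in> B x. 1)"
      using BE by (intro sum.cong) (auto intro!: arg_cong[where f = card])
    also have "\<dots> = (\<Sum>e\<in>E. \<Sum>x | x \<in> S \<and> e \<in> B x. 1)"
      using finS finite_E by (rule sum.swap_restrict)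
    also have "\<dots> \<le> (\<Sum>e\<in>E. 2)"
      by (rule sum_mono) (use two in simp)
    finally have "4 * card S \<le> card E" by simp
    then show ?thesis using S(2) by linarith
  qed
qed

end

section \<open>Edge sets whose removal increases the domination number\<close>

lemma finite_dominating_sets:
  assumes "finite V"
  shows "finite {card S |S. dominating V E S}"
proof -
  have "{card S |S. dominating V E S} \<subseteq> card ` Pow V" by (auto simp: dominating_def)
  then show ?thesis using assms finite_subset by blast
qed

lemma domination_number_le:
  assumes "finite V" "dominating V E S"
  shows "domination_number V E \<le> card S"
  unfolding domination_number_def using assms by (intro Min_le finite_dominating_sets) auto

lemma domination_number_attained:
  assumes "finite V"
  obtains S where "dominating V E S" "card S = domination_number V E"
proof -
  have "dominating V E V" by (auto simp: dominating_def)
  then have "domination_number V E \<in> {card S |S. dominating V E S}"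
    unfolding domination_number_def using assms by (intro Min_in finite_dominating_sets) auto
  then show ?thesis using that by auto
qed

text \<open>The witness of an increase is a path of at most two edges from \<open>u\<close> to \<open>v\<close> with middle
  vertex \<open>w\<close>, where \<open>w = u\<close> stands for a single edge: removing \<open>F\<close> isolates \<open>v\<close> and leaves \<open>u\<close> no
  neighbour except possibly \<open>w\<close>.\<close>

definition near_pair :: "'a set set \<Rightarrow> 'a \<Rightarrow> 'a \<Rightarrow> 'a \<Rightarrow> bool" where
  "near_pair E u v w \<longleftrightarrow> u \<noteq> v \<and> {w, v} \<in> E \<and> (w = u \<or> {w, u} \<in> E)"

definition cut_off :: "'a set \<Rightarrow> 'a set set \<Rightarrow> 'a set set \<Rightarrow> 'a \<Rightarrow> 'a \<Rightarrow> 'a \<Rightarrow> bool" where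
  "cut_off V E F u v w \<longleftrightarrow>
     (\<forall>y\<in>V. ({v, y} \<in> E \<longrightarrow> {v, y} \<in> F) \<and> ({u, y} \<in> E \<longrightarrow> y = w \<or> {u, y} \<in> F))"

text \<open>A dominating set after the removal contains \<open>v\<close>. If it contains \<open>w\<close>, then \<open>v\<close> is
  superfluous before the removal; otherwise it contains \<open>u\<close> as well, and \<open>w\<close> can replace both
  \<open>u\<close> and \<open>v\<close>.\<close>

lemma cut_off_increases_domination:
  assumes G: "simple_graph V E" and uvw: "u \<in> V" "v \<in> V" "w \<in> V"
    and near: "near_pair E u v w" and cut: "cut_off V E F u v w"
  shows "domination_number V E < domination_number V (E - F)"
proof -
  have fin: "finite V" using G by (simp add: simple_graph_def)
  obtain D where D: "dominating V (E - F) D" "card D = domination_number V (E - F)"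
    using domination_number_attained[OF fin] .
  have DV: "D \<subseteq> V" and finD: "finite D"
    using D(1) fin finite_subset by (auto simp: dominating_def)
  have isolated: "{y, v} \<notin> E - F" "{v, y} \<notin> E - F" for y
  proof -
    have "y \<in> V" if "{v, y} \<in> E" using that G by (auto simp: simple_graph_def)
    then show "{v, y} \<notin> E - F" using cut by (auto simp: cut_off_def)
    then show "{y, v} \<notin> E - F" by (simp add: insert_commute)
  qed
  have u_only: "y = w" if "{u, y} \<in> E - F \<or> {y, u} \<in> E - F" for y
  proof -
    have e: "{u, y} \<in> E - F" using that by (auto simp: insert_commute)
    then have "y \<in> V" using G by (auto simp: simple_graph_def)
    then show ?thesis using e cut by (auto simp: cut_off_def)
  qed
  have dom: "x \<in> D \<or> (\<exists>y\<in>D. {y, x} \<in> E - F)" if "x \<in> V" for x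
    using D(1) that by (auto simp: dominating_def)
  have vD: "v \<in> D" using dom[OF uvw(2)] isolated by blast
  have wv: "{w, v} \<in> E" and uv: "u \<noteq> v" and wu: "w = u \<or> {w, u} \<in> E"
    using near by (auto simp: near_pair_def)
  have "w \<noteq> v"
  proof
    assume "w = v"
    then have "{v} \<in> E" using wv by simp
    then show False using G by (auto simp: simple_graph_def)
  qed
  show ?thesis
  proof (cases "w \<in> D")
    case True
    have "dominating V E (D - {v})"
      unfolding dominating_def
    proof (intro conjI ballI)
      fix x assume x: "x \<in> V"
      show "x \<in> D - {v} \<or> (\<exists>y\<in>D - {v}. {y, x} \<in> E)"
      proof (cases "x = v")
        case True
        then show ?thesis using \<open>w \<in> D\<close> \<open>w \<noteq> v\<close> wv by blast
      next
        case False
        have "y \<noteq> v" if "{y, x} \<in> E - F" for y using that isolated(2)[of x] by auto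
        then show ?thesis using dom[OF x] False by blast
      qed
    qed (use DV in blast)
    then have "domination_number V E \<le> card (D - {v})" by (rule domination_number_le[OF fin])
    also have "\<dots> < card D" by (rule card_Diff1_less[OF finD vD])
    finally show ?thesis using D(2) by simp
  next
    case False
    have uD: "u \<in> D" using dom[OF uvw(1)] u_only False by blast
    have "w \<noteq> u" using False uD by blast
    have "dominating V E (insert w (D - {u, v}))"
      unfolding dominating_def
    proof (intro conjI ballI)
      fix x assume x: "x \<in> V"
      show "x \<in> insert w (D - {u, v}) \<or> (\<exists>y\<in>insert w (D - {u, v}). {y, x} \<in> E)"
      proof (cases "x = u \<or> x = v")
        case True
        then show ?thesis using wv wu \<open>w \<noteq> u\<close> by auto
      next
        case x_new: False
        show ?thesis
        proof (cases "x \<in> D")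
          case False
          then obtain y where y: "y \<in> D" "{y, x} \<in> E - F" using dom[OF x] by blast
          have "y \<noteq> v" using y(2) isolated(2)[of x] by auto
          moreover have "x = w" if "y = u" using u_only[of x] y(2) that by simp
          ultimately show ?thesis using y by auto
        qed (use x_new in simp)
      qed
    qed (use DV uvw in blast)
    then have "domination_number V E \<le> card (insert w (D - {u, v}))" by (rule domination_number_le[OF fin])
    also have "\<dots> \<le> card (D - {u, v}) + 1" by (simp add: card_insert_if finD)
    also have "card (D - {u, v}) = card D - 2"
      using uD vD uv finD by (simp add: card_Diff_subset)
    also have "card D \<ge> 2"
      using card_mono[of D "{u, v}"] uD vD uv finD by simp
    then have "card D - 2 + 1 < card D" by simp
    finally show ?thesis using D(2) by simp
  qed
qed

definition edges_at :: "'a set set \<Rightarrow> 'a \<Rightarrow> 'a set set" where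
  "edges_at E v = {e \<in> E. v \<in> e}"

text \<open>Take all edges at \<open>u\<close> and \<open>v\<close>. If \<open>w = u\<close>, the edge \<open>uv\<close> has been counted twice; otherwise
  the edge from \<open>u\<close> to \<open>w\<close> can be spared. Either way there are at most three.\<close>

lemma cut_off_with_few_edges:
  assumes fin: "finite E" and near: "near_pair E u v w"
    and few: "card (edges_at E u) + card (edges_at E v) \<le> 4" and E3: "3 \<le> card E"
  obtains F where "F \<subseteq> E" "card F = 3" "cut_off V E F u v w"
proof -
  \<comment> \<open>\<open>ux\<close> is the edge that is counted once only or spared.\<close>
  define x where "x = (if w = u then v else w)"
  have x: "{u, x} \<in> edges_at E u" "w = u \<Longrightarrow> x = v" "w \<noteq> u \<Longrightarrow> x = w"
    using near by (auto simp: x_def near_pair_def edges_at_def insert_commute)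
  let ?F = "edges_at E v \<union> (edges_at E u - {{u, x}})"
  have finu: "finite (edges_at E u)" "finite (edges_at E v)" using fin by (auto simp: edges_at_def)
  have "card ?F \<le> card (edges_at E v) + card (edges_at E u - {{u, x}})" by (rule card_Un_le)
  also have "card (edges_at E u - {{u, x}}) = card (edges_at E u) - 1"
    using x by simp
  also have "card (edges_at E u) > 0" using x(1) finu by (auto simp: card_gt_0_iff)
  then have "card (edges_at E v) + (card (edges_at E u) - 1) \<le> 3" using few by linarith
  finally have F3: "card ?F \<le> 3" by simp
  have FE: "?F \<subseteq> E" by (auto simp: edges_at_def)
  obtain F where F: "?F \<subseteq> F" "F \<subseteq> E" "card F = 3"
    using exists_subset_between[OF F3 E3 FE fin] by metis
  have "cut_off V E F u v w"
    unfolding cut_off_def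
  proof (intro ballI conjI impI)
    fix y assume "{v, y} \<in> E"
    then have "{v, y} \<in> edges_at E v" by (simp add: edges_at_def)
    then show "{v, y} \<in> F" using F(1) by blast
  next
    fix y assume y: "{u, y} \<in> E"
    show "y = w \<or> {u, y} \<in> F"
    proof (cases "{u, y} = {u, x}")
      case True
      then have "y = x" by (auto simp: doubleton_eq_iff)
      show ?thesis
      proof (cases "w = u")
        case True
        then have "{u, y} \<in> edges_at E v" using x(2) y \<open>y = x\<close> by (simp add: edges_at_def)
        then show ?thesis using F(1) by blast
      qed (use x(3) \<open>y = x\<close> in simp)
    next
      case False
      then have "{u, y} \<in> edges_at E u - {{u, x}}" using y by (simp add: edges_at_def)
      then show ?thesis using F(1) by blast
    qed
  qed
  then show ?thesis using that F by blast
qed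

section \<open>A close pair of vertices of small degree\<close>

text \<open>The same drawing serves. Two edges cannot meet in a vertex that has been removed, because
  an edge passes through no vertices but its ends.\<close>

lemma planar_subgraph:
  assumes "planar V E" "simple_graph V E" "W \<subseteq> V" "E' \<subseteq> E" "\<And>e. e \<in> E' \<Longrightarrow> e \<subseteq> W"
  shows "planar W E'"
proof -
  obtain pt curve where P: "plane_drawing V E pt curve" using assms(1) by (auto simp: planar_def)
  interpret drawn_graph V E pt curve using P assms(2) by unfold_locales
  have at: "path_image (curve e) \<inter> pt ` W = pt ` e" if "e \<in> E'" for e
  proof -
    have "e \<in> E" "e \<inter> W = e" using that assms(4,5) by auto
    then show ?thesis using curve_Int_points_of[OF _ assms(3), of e] by simp
  qed
  have "plane_drawing W E' pt curve"
    unfolding plane_drawing_def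
  proof (intro conjI ballI impI)
    show "inj_on pt W" using inj_pt assms(3) by (rule inj_on_subset)
  next
    fix e assume e: "e \<in> E'"
    then have "e \<in> E" using assms(4) by blast
    then show "arc (curve e)" "{pathstart (curve e), pathfinish (curve e)} = pt ` e"
      by (rule arc_curve, intro curve_ends)
    show "path_image (curve e) \<inter> pt ` W = pt ` e" by (rule at[OF e])
  next
    fix e f assume ef: "e \<in> E'" "f \<in> E'" "e \<noteq> f"
    then have E: "e \<in> E" "f \<in> E" using assms(4) by auto
    have "path_image (curve e) \<inter> path_image (curve f) \<subseteq> path_image (curve e) \<inter> pt ` V"
      using curves_Int[OF E ef(3)] by simp
    also have "\<dots> = pt ` e" by (rule curve_Int_points[OF E(1)])
    also have "\<dots> \<subseteq> pt ` W" using assms(5)[OF ef(1)] by (rule image_mono)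
    finally show "path_image (curve e) \<inter> path_image (curve f) \<subseteq> pt ` W" .
  qed
  then show ?thesis by (auto simp: planar_def)
qed

lemma card_neighbours:
  assumes "simple_graph V E"
  shows "card {w. {v, w} \<in> E} = card (edges_at E v)"
proof -
  have "edges_at E v = (\<lambda>w. {v, w}) ` {w. {v, w} \<in> E}"
  proof
    show "edges_at E v \<subseteq> (\<lambda>w. {v, w}) ` {w. {v, w} \<in> E}"
    proof
      fix e assume e: "e \<in> edges_at E v"
      then have "card e = 2" using assms by (auto simp: edges_at_def simple_graph_def)
      then obtain w where "e = {v, w}"
        using e by (auto simp: edges_at_def card_2_iff insert_commute)
      then show "e \<in> (\<lambda>w. {v, w}) ` {w. {v, w} \<in> E}" using e by (auto simp: edges_at_def)
    qed
  qed (auto simp: edges_at_def)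
  moreover have "inj_on (\<lambda>w. {v, w}) {w. {v, w} \<in> E}"
    by (auto simp: inj_on_def doubleton_eq_iff)
  ultimately show ?thesis by (simp add: card_image)
qed

lemma sum_card_edges_at:
  assumes "simple_graph V E" "finite E"
  shows "(\<Sum>v\<in>V. card (edges_at E v)) = 2 * card E"
proof -
  have fin: "finite V" using assms(1) by (simp add: simple_graph_def)
  have "(\<Sum>v\<in>V. card (edges_at E v)) = (\<Sum>v\<in>V. \<Sum>e | e \<in> E \<and> v \<in> e. 1)"
    by (simp add: edges_at_def)
  also have "\<dots> = (\<Sum>e\<in>E. \<Sum>v | v \<in> V \<and> v \<in> e. 1)"
    using fin assms(2) by (rule sum.swap_restrict)
  also have "\<dots> = (\<Sum>e\<in>E. 2)"
  proof (rule sum.cong[OF refl])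
    fix e assume "e \<in> E"
    then have "{v. v \<in> V \<and> v \<in> e} = e" "card e = 2"
      using assms(1) by (auto simp: simple_graph_def)
    then show "(\<Sum>v | v \<in> V \<and> v \<in> e. 1) = (2::nat)" by simp
  qed
  finally show ?thesis by simp
qed

text \<open>Suppose that there is no such pair, and remove the vertices of degree at most 1. A vertex
  that stays loses at most one neighbour, and only if it has degree at least 4, so the remaining
  degrees are at least 2; those of degree 2 have kept all their edges, are pairwise
  non-adjacent, and no two of them have a common neighbour. Hence the vertices of degree 2 are
  at most a third of all, and the average degree is at least 8/3, more than a planar graph
  without cycles shorter than 8 allows.\<close>

lemma near_pair_of_small_degree:
  assumes G: "simple_graph V E" and pl: "planar V E" and ne: "E \<noteq> {}"
    and long: "\<And>c. cycle_in E c \<Longrightarrow> 8 \<le> length c"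
  obtains u v w where "u \<in> V" "v \<in> V" "w \<in> V" "near_pair E u v w"
    "card (edges_at E u) + card (edges_at E v) \<le> 4"
proof (rule ccontr)
  note small = that
  define d where "d v = card (edges_at E v)" for v
  have fin: "finite V" and finE: "finite E"
    using G finite_subset[of E "Pow V"] by (auto simp: simple_graph_def)
  have edge: "a \<in> V" "b \<in> V" "a \<noteq> b" if "{a, b} \<in> E" for a b
    using that G by (auto simp: simple_graph_def)
  assume not_thesis: "\<not> thesis"
  have far: "d u + d v \<ge> 5" if "u \<in> V" "v \<in> V" "w \<in> V" "near_pair E u v w" for u v w
  proof (rule ccontr)
    assume "\<not> 5 \<le> d u + d v"
    then have "card (edges_at E u) + card (edges_at E v) \<le> 4" by (simp add: d_def)
    from small[OF that this] not_thesis show False by contradiction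
  qed
  have adj: "d u + d v \<ge> 5" if "{u, v} \<in> E" for u v
    using far[of u v u] edge[OF that] that by (simp add: near_pair_def)
  have common: "d u + d v \<ge> 5" if "{w, u} \<in> E" "{w, v} \<in> E" "u \<noteq> v" for u v w
    using far[of u v w] edge[OF that(1)] edge[OF that(2)] that by (simp add: near_pair_def)
  define W where "W = {v \<in> V. d v \<ge> 2}"
  define E' where "E' = {e \<in> E. e \<subseteq> W}"
  define d' where "d' v = card (edges_at E' v)" for v
  have WV: "W \<subseteq> V" and finW: "finite W" using fin by (auto simp: W_def)
  have finE': "finite E'" using finE by (simp add: E'_def)
  have fin_at: "finite (edges_at E v)" "finite (edges_at E' v)" for v
    using finE finE' by (auto simp: edges_at_def)
  have G': "simple_graph W E'" using G finW by (auto simp: simple_graph_def E'_def)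
  have "W \<noteq> {}"
  proof -
    obtain e where e: "e \<in> E" using ne by blast
    then have "card e = 2" using G by (auto simp: simple_graph_def)
    then obtain a b where "e = {a, b}" by (auto simp: card_2_iff)
    then have ab: "{a, b} \<in> E" using e by simp
    then have "d a \<ge> 2 \<or> d b \<ge> 2" using adj[OF ab] by linarith
    then show ?thesis using edge[OF ab] by (auto simp: W_def)
  qed
  have upper: "3 * card E' < 4 * card W"
  proof -
    have "planar W E'" by (rule planar_subgraph[OF pl G WV]) (simp_all add: E'_def)
    then obtain pt curve where "plane_drawing W E' pt curve" unfolding planar_def by blast
    with G' have "drawn_graph W E' pt curve" by (rule drawn_graph.intro)
    then show ?thesis
    proof (rule drawn_graph.card_edges_less)
      fix c assume "cycle_in E' c"
      then have "cycle_in E c" by (auto simp: cycle_in_def E'_def)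
      then show "8 \<le> length c" by (rule long)
    qed (rule \<open>W \<noteq> {}\<close>)
  qed
  have lost: "d v \<le> d' v + 1 \<and> (d v \<noteq> d' v \<longrightarrow> d v \<ge> 4)" if v: "v \<in> W" for v
  proof -
    let ?L = "edges_at E v - edges_at E' v"
    have leaf: "\<exists>l. e = {v, l} \<and> {v, l} \<in> E \<and> d l \<le> 1" if e: "e \<in> ?L" for e
    proof -
      have "card e = 2" using e G by (auto simp: edges_at_def simple_graph_def)
      then obtain l where l: "e = {v, l}"
        using e by (auto simp: edges_at_def card_2_iff insert_commute)
      then have lE: "{v, l} \<in> E" using e by (auto simp: edges_at_def)
      have "l \<notin> W" using e l lE v by (auto simp: edges_at_def E'_def)
      then show ?thesis using l lE edge[OF lE] by (auto simp: W_def)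
    qed
    have "e = f" if ef: "e \<in> ?L" "f \<in> ?L" for e f
    proof -
      obtain k l where kl: "e = {v, k}" "{v, k} \<in> E" "d k \<le> 1" "f = {v, l}" "{v, l} \<in> E" "d l \<le> 1"
        using leaf[OF ef(1)] leaf[OF ef(2)] by blast
      then show ?thesis using common[of v k l] by fastforce
    qed
    then have L1: "card ?L \<le> 1"
      using fin_at by (simp add: card_le_Suc0_iff_eq)
    have "edges_at E' v \<subseteq> edges_at E v" by (auto simp: edges_at_def E'_def)
    then have eq: "d v = d' v + card ?L"
      using fin_at card_mono[of "edges_at E v" "edges_at E' v"]
      by (simp add: d_def d'_def card_Diff_subset)
    have "d v \<ge> 4" if L: "?L \<noteq> {}"
    proof -
      obtain e where "e \<in> ?L" using L by blast
      then obtain l where "{v, l} \<in> E" "d l \<le> 1" using leaf by blast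
      then show ?thesis using adj[of v l] by linarith
    qed
    then show ?thesis using L1 eq by (cases "?L = {}") auto
  qed
  define M where "M = {v \<in> W. d' v = 2}"
  have M2: "d v = 2" if "v \<in> M" for v
    using that lost[of v] by (auto simp: M_def)
  have d'3: "d' v \<ge> 3" if "v \<in> W - M" for v
  proof -
    have "d v \<ge> 2" "d' v \<noteq> 2" using that by (auto simp: W_def M_def)
    then show ?thesis using lost[of v] that by auto
  qed
  have finM: "finite M" and MW: "M \<subseteq> W" using finW by (auto simp: M_def)
  define N where "N v = {w. {v, w} \<in> E'}" for v
  have NE: "{v, w} \<in> E" "w \<in> W" if "w \<in> N v" for v w
    using that by (auto simp: N_def E'_def)
  have "2 * card M = (\<Sum>v\<in>M. card (N v))"
    using card_neighbours[OF G'] by (simp add: N_def M_def d'_def)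
  also have "\<dots> = card (\<Union>v\<in>M. N v)"
  proof (rule card_UN_disjoint[symmetric])
    show "\<forall>v\<in>M. finite (N v)"
      using NE(2) finW by (auto intro: finite_subset[of _ W])
    show "\<forall>u\<in>M. \<forall>v\<in>M. u \<noteq> v \<longrightarrow> N u \<inter> N v = {}"
    proof (intro ballI impI equals0I)
      fix u v w assume uv: "u \<in> M" "v \<in> M" "u \<noteq> v" and w: "w \<in> N u \<inter> N v"
      have "{w, u} \<in> E" "{w, v} \<in> E" using w NE(1)[of w u] NE(1)[of w v] by (auto simp: insert_commute)
      then show False using common[of w u v] uv M2[of u] M2[of v] by simp
    qed
  qed (rule finM)
  also have "\<dots> \<le> card (W - M)"
  proof (rule card_mono)
    show "(\<Union>v\<in>M. N v) \<subseteq> W - M"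
    proof (rule UN_least)
      fix v assume v: "v \<in> M"
      show "N v \<subseteq> W - M"
      proof
        fix w assume w: "w \<in> N v"
        have "w \<notin> M" using adj[OF NE(1)[OF w]] M2[OF v] M2[of w] by auto
        then show "w \<in> W - M" using NE(2)[OF w] by simp
      qed
    qed
  qed (use finW in simp)
  finally have M: "2 * card M \<le> card (W - M)" .
  have split: "card W = card M + card (W - M)"
    using MW finW finM card_mono[OF finW MW] by (simp add: card_Diff_subset)
  have "2 * card M + 3 * card (W - M) = (\<Sum>v\<in>M. 2) + (\<Sum>v\<in>W - M. 3)" by simp
  also have "\<dots> \<le> (\<Sum>v\<in>M. d' v) + (\<Sum>v\<in>W - M. d' v)"
    using d'3 by (intro add_mono sum_mono) (auto simp: M_def)
  also have "\<dots> = (\<Sum>v\<in>W. d' v)"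
    using sum.subset_diff[OF MW finW, of d'] by simp
  also have "\<dots> = 2 * card E'"
    unfolding d'_def by (rule sum_card_edges_at[OF G' finE'])
  finally show False using M split upper by linarith
qed

section \<open>Exhaustive search on the machine\<close>

text \<open>Variable \<open>i\<close> of a formula lives in register \<open>2 * i + 8\<close>, and the register after it counts
  the values still to be tried. Register 0 holds the number of vertices, register 1 receives
  truth values, and registers 2 to 7 are scratch.\<close>

abbreviation var :: "nat \<Rightarrow> nat" where "var i \<equiv> 2 * i + 8"
abbreviation counter :: "nat \<Rightarrow> nat" where "counter i \<equiv> 2 * i + 9"

definition vals :: "nat \<Rightarrow> state \<Rightarrow> nat list" where
  "vals k s = map (\<lambda>i. reg s (var i)) [0..<k]"

definition preserves :: "nat \<Rightarrow> state \<Rightarrow> state \<Rightarrow> bool" where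
  "preserves k s s' \<longleftrightarrow> mem s' = mem s \<and> (\<forall>r. r = 0 \<or> 8 \<le> r \<and> r < var k \<longrightarrow> reg s' r = reg s r)"

text \<open>A formula is a predicate on the number of vertices, the memory, and the values of its
  variables. In the scope of \<open>k\<close> variables, a program searches for \<open>m\<close> more that satisfy \<open>Q\<close>; if
  it succeeds, it leaves them in their registers. For \<open>m = 0\<close> it just decides \<open>Q\<close>.\<close>

definition searches :: "nat \<Rightarrow> nat \<Rightarrow> (nat \<Rightarrow> (nat \<Rightarrow> nat) \<Rightarrow> nat list \<Rightarrow> bool) \<Rightarrow> prog \<Rightarrow> nat poly \<Rightarrow> bool" where
  "searches k m Q P p \<longleftrightarrow> (\<forall>s. \<exists>t s'. run P s t s' \<and> t \<le> poly p (reg s 0) \<and> preserves k s s'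
     \<and> (reg s' 1 = 1 \<and> set (drop k (vals (k + m) s')) \<subseteq> {..<reg s 0} \<and> Q (reg s 0) (mem s) (vals (k + m) s')
        \<or> reg s' 1 = 0 \<and> (\<forall>ys. length ys = m \<longrightarrow> set ys \<subseteq> {..<reg s 0} \<longrightarrow> \<not> Q (reg s 0) (mem s) (vals k s @ ys))))"

definition decidable :: "nat \<Rightarrow> (nat \<Rightarrow> (nat \<Rightarrow> nat) \<Rightarrow> nat list \<Rightarrow> bool) \<Rightarrow> bool" where
  "decidable k Q \<longleftrightarrow> (\<exists>P p. searches k 0 Q P p)"

lemma length_vals [simp]: "length (vals k s) = k"
  by (simp add: vals_def)

lemma nth_vals [simp]: "i < k \<Longrightarrow> vals k s ! i = reg s (var i)"
  by (simp add: vals_def)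

lemma vals_Suc: "vals (Suc k) s = vals k s @ [reg s (var k)]"
  by (simp add: vals_def)

lemma preserves_refl: "preserves k s s"
  by (simp add: preserves_def)

lemma preserves_trans: "preserves k s s' \<Longrightarrow> preserves k s' s'' \<Longrightarrow> preserves k s s''"
  by (simp add: preserves_def)

lemma preserves_le:
  assumes "preserves k s s'" "j \<le> k"
  shows "preserves j s s'"
proof -
  have "r = 0 \<or> 8 \<le> r \<and> r < var k" if "r = 0 \<or> 8 \<le> r \<and> r < var j" for r
    using that assms(2) by linarith
  then show ?thesis using assms(1) unfolding preserves_def by blast
qed

lemma preserves_vals: "preserves k s s' \<Longrightarrow> vals k s' = vals k s"
  by (simp add: preserves_def vals_def)

lemma preserves_simps:
  assumes "preserves k s s'"
  shows "reg s' 0 = reg s 0" "mem s' = mem s" "i < k \<Longrightarrow> reg s' (var i) = reg s (var i)"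
    "i < k \<Longrightarrow> reg s' (counter i) = reg s (counter i)"
  using assms unfolding preserves_def by simp_all

lemma preserves_set_reg: "r \<noteq> 0 \<Longrightarrow> r < 8 \<or> var k \<le> r \<Longrightarrow> preserves k s (set_reg r x s)"
  unfolding preserves_def by (simp, linarith)

lemma decides_iff: "searches k 0 Q P p \<longleftrightarrow>
  (\<forall>s. \<exists>t s'. run P s t s' \<and> t \<le> poly p (reg s 0) \<and> preserves k s s'
     \<and> reg s' 1 = (if Q (reg s 0) (mem s) (vals k s) then 1 else 0))"
proof -
  have "(reg s' 1 = 1 \<and> set (drop k (vals (k + 0) s')) \<subseteq> {..<reg s 0} \<and> Q (reg s 0) (mem s) (vals (k + 0) s')
        \<or> reg s' 1 = 0 \<and> (\<forall>ys. length ys = 0 \<longrightarrow> set ys \<subseteq> {..<reg s 0} \<longrightarrow> \<not> Q (reg s 0) (mem s) (vals k s @ ys)))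
     \<longleftrightarrow> reg s' 1 = (if Q (reg s 0) (mem s) (vals k s) then 1 else 0)" if "preserves k s s'" for s s'
    using preserves_vals[OF that] by auto
  then show ?thesis unfolding searches_def by meson
qed

lemma decidableI:
  assumes "\<And>s. \<exists>t s'. run P s t s' \<and> t \<le> poly p (reg s 0) \<and> preserves k s s'
     \<and> reg s' 1 = (if Q (reg s 0) (mem s) (vals k s) then 1 else 0)"
  shows "decidable k Q"
  unfolding decidable_def decides_iff by (intro exI[of _ P] exI[of _ p] allI assms)

lemma decidableE:
  assumes "decidable k Q"
  obtains P p where "\<And>s. \<exists>t s'. run P s t s' \<and> t \<le> poly p (reg s 0) \<and> preserves k s s'
     \<and> reg s' 1 = (if Q (reg s 0) (mem s) (vals k s) then 1 else 0)"
proof -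
  obtain P p where "searches k 0 Q P p" using assms unfolding decidable_def by (elim exE)
  then show thesis unfolding decides_iff by (intro that) (rule spec)
qed

lemma run_IfPos:
  assumes "run (if reg s r > 0 then P else Q) s t s'"
  shows "run (IfPos r P Q) s (Suc t) s'"
proof (cases "reg s r > 0")
  case True
  then show ?thesis using assms by (intro run.If_pos) simp_all
next
  case False
  then show ?thesis using assms by (intro run.If_zero) simp_all
qed

lemma decidable_eq:
  assumes "i < k" "j < k"
  shows "decidable k (\<lambda>n M xs. xs ! i = xs ! j)"
proof (rule decidableI)
  fix s :: state
  let ?P = "Seq (Sub 1 (var i) (var j)) (Seq (Sub 2 (var j) (var i)) (Seq (Add 1 1 2)
    (IfPos 1 (Const 1 0) (Const 1 1))))"
  let ?x = "reg s (var i)" and ?y = "reg s (var j)"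
  define s1 where "s1 = set_reg 1 (?x - ?y) s"
  define s2 where "s2 = set_reg 2 (?y - ?x) s1"
  define s3 where "s3 = set_reg 1 ((?x - ?y) + (?y - ?x)) s2"
  define s4 where "s4 = set_reg 1 (if ?x = ?y then 1 else 0) s3"
  have 1: "run (Sub 1 (var i) (var j)) s 1 s1"
    using run.Sub[of 1 "var i" "var j" s] by (simp add: s1_def)
  have 2: "run (Sub 2 (var j) (var i)) s1 1 s2"
    using run.Sub[of 2 "var j" "var i" s1] by (simp add: s1_def s2_def)
  have 3: "run (Add 1 1 2) s2 1 s3"
    using run.Add[of 1 1 2 s2] by (simp add: s1_def s2_def s3_def)
  have 4: "run (IfPos 1 (Const 1 0) (Const 1 1)) s3 (Suc 1) s4"
  proof (rule run_IfPos)
    have "reg s3 1 > 0 \<longleftrightarrow> ?x \<noteq> ?y" by (auto simp: s3_def)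
    then show "run (if reg s3 1 > 0 then Const 1 0 else Const 1 1) s3 1 s4"
      using run.Const[of 1 _ s3] by (simp add: s4_def)
  qed
  have "run ?P s (1 + (1 + (1 + Suc 1))) s4"
    by (intro run.Seq[OF 1] run.Seq[OF 2] run.Seq[OF 3] 4)
  moreover have "preserves k s s4"
    by (auto simp: preserves_def s1_def s2_def s3_def s4_def)
  moreover have "reg s4 1 = (if vals k s ! i = vals k s ! j then 1 else 0)"
    using assms by (simp add: s4_def)
  ultimately show "\<exists>t s'. run ?P s t s' \<and> t \<le> poly [:5:] (reg s 0) \<and> preserves k s s'
     \<and> reg s' 1 = (if vals k s ! i = vals k s ! j then 1 else 0)"
    by (intro exI[of _ "1 + (1 + (1 + Suc 1))"] exI[of _ s4]) simp
qed

text \<open>For want of a multiplication, the row offset \<open>xs ! i * n\<close> is summed up in \<open>n\<close> additions.\<close>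

lemma run_multiply:
  assumes "reg s 3 = 1" "x \<notin> {3, 4, 5}"
  shows "\<exists>t. run (WhilePos 5 (Seq (Add 4 4 x) (Sub 5 5 3))) s t
      (s\<lparr>reg := (reg s)(4 := reg s 4 + reg s 5 * reg s x, 5 := 0)\<rparr>) \<and> t \<le> 3 * reg s 5 + 1"
  using assms
proof (induction "reg s 5" arbitrary: s)
  case 0
  then have "s\<lparr>reg := (reg s)(4 := reg s 4 + reg s 5 * reg s x, 5 := 0)\<rparr> = s"
    by (cases s) (auto simp: fun_eq_iff)
  then show ?case using run.While_zero[of s 5] 0 by (metis One_nat_def le_add2)
next
  case (Suc c)
  define s1 where "s1 = set_reg 4 (reg s 4 + reg s x) s"
  define s2 where "s2 = set_reg 5 c s1"
  have 1: "run (Add 4 4 x) s 1 s1"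
    using run.Add[of 4 4 x s] by (simp add: s1_def)
  have c: "reg s 5 - reg s 3 = c" using Suc.hyps(2) Suc.prems by simp
  have 2: "run (Sub 5 5 3) s1 1 s2"
    using run.Sub[of 5 5 3 s1] c by (simp add: s1_def s2_def)
  have "c = reg s2 5" "reg s2 3 = 1" using Suc.prems by (simp_all add: s1_def s2_def)
  from Suc.hyps(1)[OF this Suc.prems(2)] obtain t where
    t: "run (WhilePos 5 (Seq (Add 4 4 x) (Sub 5 5 3))) s2 t
      (s2\<lparr>reg := (reg s2)(4 := reg s2 4 + reg s2 5 * reg s2 x, 5 := 0)\<rparr>)" "t \<le> 3 * reg s2 5 + 1"
    by blast
  have "s2\<lparr>reg := (reg s2)(4 := reg s2 4 + reg s2 5 * reg s2 x, 5 := 0)\<rparr>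
    = s\<lparr>reg := (reg s)(4 := reg s 4 + reg s 5 * reg s x, 5 := 0)\<rparr>"
    using Suc.prems Suc.hyps(2)[symmetric] by (auto simp: s1_def s2_def fun_eq_iff)
  moreover have "run (WhilePos 5 (Seq (Add 4 4 x) (Sub 5 5 3))) s (Suc ((1 + 1) + t))
      (s2\<lparr>reg := (reg s2)(4 := reg s2 4 + reg s2 5 * reg s2 x, 5 := 0)\<rparr>)"
    by (rule run.While_pos[OF _ run.Seq[OF 1 2] t(1)]) (use Suc.hyps(2) in simp)
  moreover have "Suc ((1 + 1) + t) \<le> 3 * reg s 5 + 1"
    using t(2) Suc.hyps(2)[symmetric] by (simp add: s2_def)
  ultimately show ?case by metis
qed

lemma decidable_adj:
  assumes "i < k" "j < k"
  shows "decidable k (\<lambda>n M xs. M (xs ! i * n + xs ! j) \<noteq> 0)"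
proof (rule decidableI)
  fix s :: state
  let ?L = "WhilePos 5 (Seq (Add 4 4 (var i)) (Sub 5 5 3))"
  let ?P = "Seq (Const 3 1) (Seq (Const 4 0) (Seq (Move 5 0) (Seq ?L (Seq (Add 4 4 (var j))
    (Seq (Load 1 4) (IfPos 1 (Const 1 1) (Const 1 0)))))))"
  let ?x = "reg s (var i)" and ?y = "reg s (var j)" and ?n = "reg s 0"
  define s1 where "s1 = set_reg 3 1 s"
  define s2 where "s2 = set_reg 4 0 s1"
  define s3 where "s3 = set_reg 5 ?n s2"
  define s4 where "s4 = s3\<lparr>reg := (reg s3)(4 := reg s3 4 + reg s3 5 * reg s3 (var i), 5 := 0)\<rparr>"
  define s5 where "s5 = set_reg 4 (?x * ?n + ?y) s4"
  define s6 where "s6 = set_reg 1 (mem s (?x * ?n + ?y)) s5"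
  define s7 where "s7 = set_reg 1 (if mem s (?x * ?n + ?y) \<noteq> 0 then 1 else 0) s6"
  have 1: "run (Const 3 1) s 1 s1" unfolding s1_def by (rule run.Const)
  have 2: "run (Const 4 0) s1 1 s2" unfolding s2_def by (rule run.Const)
  have 3: "run (Move 5 0) s2 1 s3"
    using run.Move[of 5 0 s2] by (simp add: s1_def s2_def s3_def)
  have "reg s3 3 = 1" "var i \<notin> {3, 4, 5}" by (auto simp: s1_def s2_def s3_def)
  from run_multiply[OF this] obtain t where t: "run ?L s3 t s4" "t \<le> 3 * reg s3 5 + 1"
    unfolding s4_def by blast
  have r3: "reg s3 5 = ?n" "reg s3 4 = 0" "reg s3 (var i) = ?x" "reg s3 (var j) = ?y"
    by (simp_all add: s1_def s2_def s3_def)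
  have 5: "run (Add 4 4 (var j)) s4 1 s5"
    using run.Add[of 4 4 "var j" s4] r3 by (simp add: s4_def s5_def mult.commute)
  have "mem s5 = mem s" by (simp add: s1_def s2_def s3_def s4_def s5_def)
  then have 6: "run (Load 1 4) s5 1 s6"
    using run.Load[of 1 4 s5] by (simp add: s5_def s6_def)
  have 7: "run (IfPos 1 (Const 1 1) (Const 1 0)) s6 (Suc 1) s7"
  proof (rule run_IfPos)
    have "reg s6 1 > 0 \<longleftrightarrow> mem s (?x * ?n + ?y) \<noteq> 0" by (simp add: s6_def)
    then show "run (if reg s6 1 > 0 then Const 1 1 else Const 1 0) s6 1 s7"
      using run.Const[of 1 _ s6] by (simp add: s7_def)
  qed
  have "run ?P s (1 + (1 + (1 + (t + (1 + (1 + Suc 1)))))) s7"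
    by (intro run.Seq[OF 1] run.Seq[OF 2] run.Seq[OF 3] run.Seq[OF t(1)] run.Seq[OF 5] run.Seq[OF 6] 7)
  moreover have "preserves k s s7"
    by (auto simp: preserves_def s1_def s2_def s3_def s4_def s5_def s6_def s7_def)
  moreover have "reg s7 1 = (if mem s (vals k s ! i * ?n + vals k s ! j) \<noteq> 0 then 1 else 0)"
    using assms by (simp add: s7_def)
  ultimately show "\<exists>t s'. run ?P s t s' \<and> t \<le> poly [:8, 3:] ?n \<and> preserves k s s'
     \<and> reg s' 1 = (if mem s (vals k s ! i * ?n + vals k s ! j) \<noteq> 0 then 1 else 0)"
    using t(2) r3(1) by (intro exI[of _ "1 + (1 + (1 + (t + (1 + (1 + Suc 1)))))"] exI[of _ s7]) simp
qed

lemma decidable_not: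
  assumes "decidable k Q"
  shows "decidable k (\<lambda>n M xs. \<not> Q n M xs)"
proof -
  obtain P p where P: "\<And>s. \<exists>t s'. run P s t s' \<and> t \<le> poly p (reg s 0) \<and> preserves k s s'
     \<and> reg s' 1 = (if Q (reg s 0) (mem s) (vals k s) then 1 else 0)"
    using decidableE[OF assms] by blast
  show ?thesis
  proof (rule decidableI)
    fix s :: state
    obtain t s' where s': "run P s t s'" "t \<le> poly p (reg s 0)" "preserves k s s'"
      "reg s' 1 = (if Q (reg s 0) (mem s) (vals k s) then 1 else 0)" using P by blast
    let ?P = "Seq P (IfPos 1 (Const 1 0) (Const 1 1))"
    define s2 where "s2 = set_reg 1 (1 - reg s' 1) s'"
    have "run (IfPos 1 (Const 1 0) (Const 1 1)) s' (Suc 1) s2"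
      by (rule run_IfPos) (use s'(4) run.Const[of 1 0 s'] run.Const[of 1 1 s'] in \<open>simp add: s2_def split: if_splits\<close>)
    then have "run ?P s (t + Suc 1) s2" by (rule run.Seq[OF s'(1)])
    moreover have "preserves k s s2"
      using preserves_trans[OF s'(3) preserves_set_reg] by (simp add: s2_def)
    moreover have "reg s2 1 = (if \<not> Q (reg s 0) (mem s) (vals k s) then 1 else 0)"
      using s'(4) by (simp add: s2_def)
    ultimately show "\<exists>t s'. run ?P s t s' \<and> t \<le> poly (p + [:2:]) (reg s 0) \<and> preserves k s s'
     \<and> reg s' 1 = (if \<not> Q (reg s 0) (mem s) (vals k s) then 1 else 0)"
      using s'(2) by (intro exI[of _ "t + Suc 1"] exI[of _ s2]) simp
  qed
qed

lemma decidable_conj: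
  assumes "decidable k Q" "decidable k R"
  shows "decidable k (\<lambda>n M xs. Q n M xs \<and> R n M xs)"
proof -
  obtain P p where P: "\<And>s. \<exists>t s'. run P s t s' \<and> t \<le> poly p (reg s 0) \<and> preserves k s s'
     \<and> reg s' 1 = (if Q (reg s 0) (mem s) (vals k s) then 1 else 0)"
    using decidableE[OF assms(1)] by blast
  obtain P' p' where P': "\<And>s. \<exists>t s'. run P' s t s' \<and> t \<le> poly p' (reg s 0) \<and> preserves k s s'
     \<and> reg s' 1 = (if R (reg s 0) (mem s) (vals k s) then 1 else 0)"
    using decidableE[OF assms(2)] by blast
  show ?thesis
  proof (rule decidableI)
    fix s :: state
    let ?P = "Seq P (IfPos 1 P' Skip)"
    obtain t s1 where s1: "run P s t s1" "t \<le> poly p (reg s 0)" "preserves k s s1"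
      "reg s1 1 = (if Q (reg s 0) (mem s) (vals k s) then 1 else 0)" using P by blast
    obtain u s2 where s2: "run P' s1 u s2" "u \<le> poly p' (reg s1 0)" "preserves k s1 s2"
      "reg s2 1 = (if R (reg s1 0) (mem s1) (vals k s1) then 1 else 0)" using P' by blast
    note same = preserves_simps(1,2)[OF s1(3)] preserves_vals[OF s1(3)]
    show "\<exists>t s'. run ?P s t s' \<and> t \<le> poly (p + p' + [:2:]) (reg s 0) \<and> preserves k s s'
     \<and> reg s' 1 = (if Q (reg s 0) (mem s) (vals k s) \<and> R (reg s 0) (mem s) (vals k s) then 1 else 0)"
    proof (cases "Q (reg s 0) (mem s) (vals k s)")
      case True
      then have "run (IfPos 1 P' Skip) s1 (Suc u) s2" using s1(4) s2(1) by (intro run_IfPos) simp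
      then have "run ?P s (t + Suc u) s2" by (rule run.Seq[OF s1(1)])
      moreover have "preserves k s s2" by (rule preserves_trans[OF s1(3) s2(3)])
      ultimately show ?thesis using s1(2) s2(2,4) same True
        by (intro exI[of _ "t + Suc u"] exI[of _ s2]) simp
    next
      case False
      then have "run (IfPos 1 P' Skip) s1 (Suc 1) s1" using s1(4) run.Skip by (intro run_IfPos) simp
      then have "run ?P s (t + Suc 1) s1" by (rule run.Seq[OF s1(1)])
      then show ?thesis using s1 False by (intro exI[of _ "t + Suc 1"] exI[of _ s1]) simp
    qed
  qed
qed

lemma decidable_disj:
  assumes "decidable k Q" "decidable k R"
  shows "decidable k (\<lambda>n M xs. Q n M xs \<or> R n M xs)"
proof -
  have "decidable k (\<lambda>n M xs. \<not> (\<not> Q n M xs \<and> \<not> R n M xs))"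
    by (intro decidable_not decidable_conj assms)
  then show ?thesis by simp
qed

lemma decidable_imp:
  assumes "decidable k Q" "decidable k R"
  shows "decidable k (\<lambda>n M xs. Q n M xs \<longrightarrow> R n M xs)"
proof -
  have "decidable k (\<lambda>n M xs. \<not> Q n M xs \<or> R n M xs)"
    by (intro decidable_not decidable_disj assms)
  then show ?thesis by (simp only: imp_conv_disj)
qed

text \<open>The values for the new variable are tried from \<open>n - 1\<close> downwards. A success zeroes the
  counter, which ends the loop with the witness still in its register.\<close>

abbreviation search_body :: "nat \<Rightarrow> prog \<Rightarrow> prog" where
  "search_body k P \<equiv> Seq (Const 2 1) (Seq (Sub (counter k) (counter k) 2) (Seq (Move (var k) (counter k))
         (Seq P (IfPos 1 (Const (counter k) 0) Skip))))"

definition search_loop :: "nat \<Rightarrow> prog \<Rightarrow> prog" where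
  "search_loop k P =
     Seq (Const 1 0) (Seq (Move (counter k) 0) (WhilePos (counter k) (search_body k P)))"

text \<open>Besides the run of \<open>P\<close>, each round takes six steps: the test of the counter, three
  assignments, and the final conditional with its branch.\<close>

lemma run_search_while:
  assumes P: "searches (Suc k) m Q P p" and "reg s 1 = 0" and "reg s (counter k) \<le> reg s 0"
  shows "\<exists>t s'. run (WhilePos (counter k) (search_body k P)) s t s'
    \<and> t \<le> reg s (counter k) * (poly p (reg s 0) + 6) + 1 \<and> preserves k s s'
    \<and> (reg s' 1 = 1 \<and> set (drop k (vals (k + Suc m) s')) \<subseteq> {..<reg s 0}
          \<and> Q (reg s 0) (mem s) (vals (k + Suc m) s')
        \<or> reg s' 1 = 0 \<and> (\<forall>x ys. x < reg s (counter k) \<longrightarrow> length ys = m \<longrightarrow> set ys \<subseteq> {..<reg s 0}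
          \<longrightarrow> \<not> Q (reg s 0) (mem s) (vals k s @ x # ys)))"
  using assms(2,3)
proof (induction "reg s (counter k)" arbitrary: s)
  case 0
  then show ?case
    using run.While_zero[of s "counter k"] preserves_refl by (intro exI[of _ 1] exI[of _ s]) auto
next
  case (Suc c)
  let ?n = "reg s 0" and ?M = "mem s" and ?W = "WhilePos (counter k) (search_body k P)"
  define s1 where "s1 = set_reg 2 1 s"
  define s2 where "s2 = set_reg (counter k) c s1"
  define s3 where "s3 = set_reg (var k) c s2"
  have 1: "run (Const 2 1) s 1 s1" unfolding s1_def by (rule run.Const)
  have 2: "run (Sub (counter k) (counter k) 2) s1 1 s2"
    using run.Sub[of "counter k" "counter k" 2 s1] Suc.hyps(2)[symmetric] by (simp add: s1_def s2_def)
  have 3: "run (Move (var k) (counter k)) s2 1 s3"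
    using run.Move[of "var k" "counter k" s2] by (simp add: s2_def s3_def)
  have r3: "reg s3 0 = ?n" "mem s3 = ?M" "reg s3 (counter k) = c" "reg s3 (var k) = c"
    by (simp_all add: s1_def s2_def s3_def)
  have p3: "preserves k s s3" by (auto simp: preserves_def s1_def s2_def s3_def)
  obtain t s4 where 4: "run P s3 t s4" "t \<le> poly p ?n" "preserves (Suc k) s3 s4"
    and res: "reg s4 1 = 1 \<and> set (drop (Suc k) (vals (Suc k + m) s4)) \<subseteq> {..<?n} \<and> Q ?n ?M (vals (Suc k + m) s4)
        \<or> reg s4 1 = 0 \<and> (\<forall>ys. length ys = m \<longrightarrow> set ys \<subseteq> {..<?n} \<longrightarrow> \<not> Q ?n ?M (vals (Suc k) s3 @ ys))"
    using P[unfolded searches_def, rule_format, of s3] r3 by metis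
  have r4: "reg s4 0 = ?n" "mem s4 = ?M" "reg s4 (counter k) = c" "reg s4 (var k) = c"
    using preserves_simps(1,2)[OF 4(3)] preserves_simps(3,4)[OF 4(3), of k] r3 by simp_all
  have p4: "preserves k s s4"
    using preserves_trans[OF p3 preserves_le[OF 4(3)]] by simp
  have body: "run (search_body k P) s (1 + (1 + (1 + (t + Suc 1)))) s5"
    if "run (if reg s4 1 > 0 then Const (counter k) 0 else Skip) s4 1 s5" for s5
    by (intro run.Seq[OF 1] run.Seq[OF 2] run.Seq[OF 3] run.Seq[OF 4(1)] run_IfPos that)
  have pos: "0 < reg s (counter k)" using Suc.hyps(2) by simp
  show ?case
  proof (cases "reg s4 1 = 0")
    case False
    then have succ: "reg s4 1 = 1" "set (drop (Suc k) (vals (Suc k + m) s4)) \<subseteq> {..<?n}"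
      "Q ?n ?M (vals (Suc k + m) s4)" using res by auto
    define s5 where "s5 = set_reg (counter k) 0 s4"
    have "run (search_body k P) s (1 + (1 + (1 + (t + Suc 1)))) s5"
      by (rule body) (use succ run.Const[of "counter k" 0 s4] in \<open>simp add: s5_def\<close>)
    moreover have "run ?W s5 1 s5" by (rule run.While_zero) (simp add: s5_def)
    ultimately have "run ?W s (Suc (1 + (1 + (1 + (t + Suc 1))) + 1)) s5"
      by (rule run.While_pos[OF pos])
    moreover have "preserves k s s5"
      using preserves_trans[OF p4 preserves_set_reg] by (simp add: s5_def)
    moreover have vals5: "vals (k + Suc m) s5 = vals (Suc k + m) s4"
    proof -
      have "var i \<noteq> counter k" for i by presburger
      then show ?thesis by (simp add: vals_def s5_def)
    qed
    moreover have "set (drop k (vals (Suc k + m) s4)) \<subseteq> {..<?n}"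
    proof -
      have "drop k (vals (Suc k + m) s4) = c # drop (Suc k) (vals (Suc k + m) s4)"
        using Cons_nth_drop_Suc[of k "vals (Suc k + m) s4", symmetric] r4 by simp
      then show ?thesis using succ(2) Suc.hyps(2) Suc.prems(2) by simp
    qed
    moreover have "Suc (1 + (1 + (1 + (t + Suc 1))) + 1) \<le> reg s (counter k) * (poly p ?n + 6) + 1"
      using 4(2) Suc.hyps(2)[symmetric] by simp
    moreover have "reg s5 1 = 1" using succ(1) by (simp add: s5_def)
    ultimately show ?thesis using succ(3)
      by (intro exI[of _ "Suc (1 + (1 + (1 + (t + Suc 1))) + 1)"] exI[of _ s5]) simp
  next
    case True
    then have fail: "\<not> Q ?n ?M (vals k s @ c # ys)" if "length ys = m" "set ys \<subseteq> {..<?n}" for ys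
      using res that r3(4) preserves_vals[OF p3] by (auto simp: vals_Suc)
    have run1: "run (search_body k P) s (1 + (1 + (1 + (t + Suc 1)))) s4"
      by (rule body) (use True run.Skip[of s4] in simp)
    have "c = reg s4 (counter k)" "reg s4 1 = 0" "reg s4 (counter k) \<le> reg s4 0"
      using r4 True Suc.hyps(2) Suc.prems(2) by simp_all
    from Suc.hyps(1)[OF this] obtain u s5 where s5: "run ?W s4 u s5"
      "u \<le> c * (poly p ?n + 6) + 1" "preserves k s4 s5"
      and res5: "reg s5 1 = 1 \<and> set (drop k (vals (k + Suc m) s5)) \<subseteq> {..<?n} \<and> Q ?n ?M (vals (k + Suc m) s5)
        \<or> reg s5 1 = 0 \<and> (\<forall>x ys. x < c \<longrightarrow> length ys = m \<longrightarrow> set ys \<subseteq> {..<?n} \<longrightarrow> \<not> Q ?n ?M (vals k s4 @ x # ys))"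
      unfolding r4 by blast
    have "run ?W s (Suc (1 + (1 + (1 + (t + Suc 1))) + u)) s5"
      by (rule run.While_pos[OF pos run1 s5(1)])
    moreover have "Suc (1 + (1 + (1 + (t + Suc 1))) + u) \<le> reg s (counter k) * (poly p ?n + 6) + 1"
      using 4(2) s5(2) Suc.hyps(2)[symmetric] by simp
    moreover have "preserves k s s5" by (rule preserves_trans[OF p4 s5(3)])
    moreover have "reg s5 1 = 1 \<and> set (drop k (vals (k + Suc m) s5)) \<subseteq> {..<?n} \<and> Q ?n ?M (vals (k + Suc m) s5)
        \<or> reg s5 1 = 0 \<and> (\<forall>x ys. x < reg s (counter k) \<longrightarrow> length ys = m \<longrightarrow> set ys \<subseteq> {..<?n}
            \<longrightarrow> \<not> Q ?n ?M (vals k s @ x # ys))"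
      using res5 fail preserves_vals[OF p4] Suc.hyps(2) by (metis less_Suc_eq)
    ultimately show ?thesis by blast
  qed
qed

lemma searches_loop:
  assumes "searches (Suc k) m Q P p"
  shows "searches k (Suc m) Q (search_loop k P) ([:0, 1:] * (p + [:6:]) + [:3:])"
  unfolding searches_def
proof
  fix s :: state
  let ?n = "reg s 0"
  define s1 where "s1 = set_reg 1 0 s"
  define s2 where "s2 = set_reg (counter k) ?n s1"
  have 1: "run (Const 1 0) s 1 s1" unfolding s1_def by (rule run.Const)
  have 2: "run (Move (counter k) 0) s1 1 s2"
    using run.Move[of "counter k" 0 s1] by (simp add: s1_def s2_def)
  have r2: "reg s2 0 = ?n" "mem s2 = mem s" "reg s2 (counter k) = ?n" "reg s2 1 = 0"
    by (simp_all add: s1_def s2_def)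
  have p2: "preserves k s s2" by (auto simp: preserves_def s1_def s2_def)
  obtain t s3 where s3: "run (WhilePos (counter k) (search_body k P)) s2 t s3"
    "t \<le> ?n * (poly p ?n + 6) + 1" "preserves k s2 s3"
    and res: "reg s3 1 = 1 \<and> set (drop k (vals (k + Suc m) s3)) \<subseteq> {..<?n} \<and> Q ?n (mem s) (vals (k + Suc m) s3)
        \<or> reg s3 1 = 0 \<and> (\<forall>x ys. x < ?n \<longrightarrow> length ys = m \<longrightarrow> set ys \<subseteq> {..<?n} \<longrightarrow> \<not> Q ?n (mem s) (vals k s @ x # ys))"
    using run_search_while[OF assms, of s2] preserves_vals[OF p2] unfolding r2 by auto
  have "run (search_loop k P) s (1 + (1 + t)) s3"
    unfolding search_loop_def by (intro run.Seq[OF 1] run.Seq[OF 2] s3(1))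
  moreover have "1 + (1 + t) \<le> poly ([:0, 1:] * (p + [:6:]) + [:3:]) ?n"
    using s3(2) by simp
  moreover have "preserves k s s3" by (rule preserves_trans[OF p2 s3(3)])
  moreover have "reg s3 1 = 1 \<and> set (drop k (vals (k + Suc m) s3)) \<subseteq> {..<?n} \<and> Q ?n (mem s) (vals (k + Suc m) s3)
        \<or> reg s3 1 = 0 \<and> (\<forall>ys. length ys = Suc m \<longrightarrow> set ys \<subseteq> {..<?n} \<longrightarrow> \<not> Q ?n (mem s) (vals k s @ ys))"
    using res by (auto simp: length_Suc_conv)
  ultimately show "\<exists>t s'. run (search_loop k P) s t s' \<and> t \<le> poly ([:0, 1:] * (p + [:6:]) + [:3:]) ?n
     \<and> preserves k s s'
     \<and> (reg s' 1 = 1 \<and> set (drop k (vals (k + Suc m) s')) \<subseteq> {..<?n} \<and> Q ?n (mem s) (vals (k + Suc m) s')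
        \<or> reg s' 1 = 0 \<and> (\<forall>ys. length ys = Suc m \<longrightarrow> set ys \<subseteq> {..<?n} \<longrightarrow> \<not> Q ?n (mem s) (vals k s @ ys)))"
    by blast
qed

text \<open>In the scope of the new quantifier its variable is number \<open>k\<close>. Otherwise \<open>R\<close> must depend
  on the first \<open>k\<close> values only, which for a concrete formula is plain from the indices.\<close>

lemma decidable_ex:
  assumes "decidable (Suc k) (\<lambda>n M xs. R n M xs (xs ! k))"
    and local: "\<And>n M xs x. length xs = k \<Longrightarrow> R n M (xs @ [x]) x \<longleftrightarrow> R n M xs x"
  shows "decidable k (\<lambda>n M xs. \<exists>x<n. R n M xs x)"
proof -
  obtain P p where "searches (Suc k) 0 (\<lambda>n M xs. R n M xs (xs ! k)) P p"
    using assms(1) by (auto simp: decidable_def)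
  from searches_loop[OF this] obtain P' p' where
    P': "searches k (Suc 0) (\<lambda>n M xs. R n M xs (xs ! k)) P' p'" by blast
  show ?thesis
  proof (rule decidableI)
    fix s :: state
    let ?n = "reg s 0"
    obtain t s' where s': "run P' s t s'" "t \<le> poly p' ?n" "preserves k s s'"
      and res: "reg s' 1 = 1 \<and> set (drop k (vals (k + Suc 0) s')) \<subseteq> {..<?n}
          \<and> R ?n (mem s) (vals (k + Suc 0) s') (vals (k + Suc 0) s' ! k)
        \<or> reg s' 1 = 0 \<and> (\<forall>ys. length ys = Suc 0 \<longrightarrow> set ys \<subseteq> {..<?n}
            \<longrightarrow> \<not> R ?n (mem s) (vals k s @ ys) ((vals k s @ ys) ! k))"
      using P'[unfolded searches_def, rule_format, of s] by blast
    have "reg s' 1 = (if \<exists>x<?n. R ?n (mem s) (vals k s) x then 1 else 0)"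
      using res
    proof (elim disjE conjE)
      assume 1: "reg s' 1 = 1" "set (drop k (vals (k + Suc 0) s')) \<subseteq> {..<?n}"
        "R ?n (mem s) (vals (k + Suc 0) s') (vals (k + Suc 0) s' ! k)"
      have v: "vals (k + Suc 0) s' = vals k s @ [reg s' (var k)]"
        using preserves_vals[OF s'(3)] by (simp add: vals_Suc)
      have "reg s' (var k) < ?n" "R ?n (mem s) (vals k s) (reg s' (var k))"
        using 1 local[of "vals k s"] unfolding v by (simp_all add: nth_append)
      then show ?thesis using 1(1) by auto
    next
      assume 0: "reg s' 1 = 0" "\<forall>ys. length ys = Suc 0 \<longrightarrow> set ys \<subseteq> {..<?n}
            \<longrightarrow> \<not> R ?n (mem s) (vals k s @ ys) ((vals k s @ ys) ! k)"
      have "\<not> R ?n (mem s) (vals k s) x" if "x < ?n" for x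
        using 0(2)[rule_format, of "[x]"] that local[of "vals k s"] by (simp add: nth_append)
      then show ?thesis using 0(1) by auto
    qed
    then show "\<exists>t s'. run P' s t s' \<and> t \<le> poly p' ?n \<and> preserves k s s'
     \<and> reg s' 1 = (if \<exists>x<?n. R ?n (mem s) (vals k s) x then 1 else 0)" using s' by blast
  qed
qed

lemma decidable_all:
  assumes "decidable (Suc k) (\<lambda>n M xs. R n M xs (xs ! k))"
    and "\<And>n M xs x. length xs = k \<Longrightarrow> R n M (xs @ [x]) x \<longleftrightarrow> R n M xs x"
  shows "decidable k (\<lambda>n M xs. \<forall>x<n. R n M xs x)"
proof -
  have "decidable k (\<lambda>n M xs. \<exists>x<n. \<not> R n M xs x)"
    using decidable_not[OF assms(1)] by (rule decidable_ex) (simp add: assms(2))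
  from decidable_not[OF this] show ?thesis by simp
qed

section \<open>Finding three edges\<close>

definition same_edge :: "nat \<Rightarrow> nat \<Rightarrow> nat \<Rightarrow> nat \<Rightarrow> bool" where
  "same_edge x y a b \<longleftrightarrow> x = a \<and> y = b \<or> x = b \<and> y = a"

definition one_of :: "nat \<Rightarrow> nat \<Rightarrow> nat \<Rightarrow> nat \<Rightarrow> nat \<Rightarrow> nat \<Rightarrow> nat \<Rightarrow> nat \<Rightarrow> bool" where
  "one_of a b c d e f x y \<longleftrightarrow> same_edge x y a b \<or> same_edge x y c d \<or> same_edge x y e f"

text \<open>For the edges \<open>ab\<close>, \<open>cd\<close> and \<open>ef\<close> this is the existence of a near pair that they cut off,
  in terms of vertex numbers and spelt out down to the equality and adjacency tests that the
  machine can perform.\<close>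

definition cutting_triple ::
  "nat \<Rightarrow> (nat \<Rightarrow> nat \<Rightarrow> bool) \<Rightarrow> nat \<Rightarrow> nat \<Rightarrow> nat \<Rightarrow> nat \<Rightarrow> nat \<Rightarrow> nat \<Rightarrow> bool" where
  "cutting_triple n A a b c d e f \<longleftrightarrow>
     A a b \<and> A c d \<and> A e f \<and> \<not> same_edge a b c d \<and> \<not> same_edge a b e f \<and> \<not> same_edge c d e f
   \<and> (\<exists>u<n. \<exists>v<n. \<exists>w<n. \<not> u = v \<and> A w v \<and> (w = u \<or> A w u)
       \<and> (\<forall>y<n. (A v y \<longrightarrow> one_of a b c d e f v y) \<and> (A u y \<longrightarrow> y = w \<or> one_of a b c d e f u y)))"

lemma decidable_cutting_triple:
  "decidable 6 (\<lambda>n M xs. cutting_triple n (\<lambda>x y. M (x * n + y) \<noteq> 0)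
     (xs ! 0) (xs ! 1) (xs ! 2) (xs ! 3) (xs ! 4) (xs ! 5))"
  unfolding cutting_triple_def one_of_def same_edge_def
  by (intro decidable_conj decidable_disj decidable_not decidable_imp decidable_ex decidable_all
      decidable_eq decidable_adj) (simp_all add: nth_append)

lemma cutting_triple_iff:
  assumes vs: "distinct vs" "set vs = V" "length vs = n"
    and A: "\<And>x y. x < n \<Longrightarrow> y < n \<Longrightarrow> A x y \<longleftrightarrow> {vs ! x, vs ! y} \<in> E"
    and less: "a < n" "b < n" "c < n" "d < n" "e < n" "f < n"
    and F: "F = {{vs ! a, vs ! b}, {vs ! c, vs ! d}, {vs ! e, vs ! f}}"
  shows "cutting_triple n A a b c d e f \<longleftrightarrow>
    F \<subseteq> E \<and> card F = 3 \<and> (\<exists>u\<in>V. \<exists>v\<in>V. \<exists>w\<in>V. near_pair E u v w \<and> cut_off V E F u v w)"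
proof -
  have eq: "vs ! x = vs ! y \<longleftrightarrow> x = y" if "x < n" "y < n" for x y
    using vs that by (simp add: nth_eq_iff_index_eq)
  have same: "same_edge x y p q \<longleftrightarrow> {vs ! x, vs ! y} = {vs ! p, vs ! q}"
    if "x < n" "y < n" "p < n" "q < n" for x y p q
    using that eq by (simp add: same_edge_def doubleton_eq_iff)
  have one: "one_of a b c d e f x y \<longleftrightarrow> {vs ! x, vs ! y} \<in> F" if "x < n" "y < n" for x y
    using that less same by (simp add: one_of_def F)
  have V: "V = (!) vs ` {..<n}"
    using vs by (auto simp: set_conv_nth)
  have ex_V: "(\<exists>x\<in>V. P x) \<longleftrightarrow> (\<exists>i<n. P (vs ! i))" for P
    unfolding V by auto
  have 1: "A a b \<and> A c d \<and> A e f \<longleftrightarrow> F \<subseteq> E"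
    using A less by (simp add: F)
  have 2: "\<not> same_edge a b c d \<and> \<not> same_edge a b e f \<and> \<not> same_edge c d e f \<longleftrightarrow> card F = 3"
    unfolding F same[OF less(1-4)] same[OF less(1,2,5,6)] same[OF less(3-6)]
    by (auto simp: card_insert_if)
  have 3: "\<not> u = v \<and> A w v \<and> (w = u \<or> A w u) \<longleftrightarrow> near_pair E (vs ! u) (vs ! v) (vs ! w)"
    if "u < n" "v < n" "w < n" for u v w
    using that A eq by (simp add: near_pair_def)
  have 4: "(\<forall>y<n. (A v y \<longrightarrow> one_of a b c d e f v y) \<and> (A u y \<longrightarrow> y = w \<or> one_of a b c d e f u y))
      \<longleftrightarrow> cut_off V E F (vs ! u) (vs ! v) (vs ! w)" if "u < n" "v < n" "w < n" for u v w
    unfolding cut_off_def V using that A eq one by (simp, simp add: Ball_def)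
  have 5: "(\<not> u = v \<and> A w v \<and> (w = u \<or> A w u)
       \<and> (\<forall>y<n. (A v y \<longrightarrow> one_of a b c d e f v y) \<and> (A u y \<longrightarrow> y = w \<or> one_of a b c d e f u y)))
    \<longleftrightarrow> near_pair E (vs ! u) (vs ! v) (vs ! w) \<and> cut_off V E F (vs ! u) (vs ! v) (vs ! w)"
    if "u < n" "v < n" "w < n" for u v w
    using 3[OF that] 4[OF that] by argo
  have "(\<exists>u<n. \<exists>v<n. \<exists>w<n. \<not> u = v \<and> A w v \<and> (w = u \<or> A w u)
       \<and> (\<forall>y<n. (A v y \<longrightarrow> one_of a b c d e f v y) \<and> (A u y \<longrightarrow> y = w \<or> one_of a b c d e f u y)))
    \<longleftrightarrow> (\<exists>u<n. \<exists>v<n. \<exists>w<n. near_pair E (vs ! u) (vs ! v) (vs ! w)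
         \<and> cut_off V E F (vs ! u) (vs ! v) (vs ! w))"
    by (simp only: 5 cong: conj_cong)
  also have "\<dots> \<longleftrightarrow> (\<exists>u\<in>V. \<exists>v\<in>V. \<exists>w\<in>V. near_pair E u v w \<and> cut_off V E F u v w)"
    by (simp only: ex_V)
  finally show ?thesis
    unfolding cutting_triple_def using 1 2 by argo
qed

lemma mem_graph_input:
  assumes "x < length vs" "y < length vs"
  shows "mem (graph_input vs E) (x * length vs + y) \<noteq> 0 \<longleftrightarrow> {vs ! x, vs ! y} \<in> E"
proof -
  have "x * length vs + y < Suc x * length vs" using assms by simp
  also have "\<dots> \<le> length vs * length vs" using assms by (intro mult_le_mono1) simp
  finally have less: "x * length vs + y < length vs * length vs" .
  have "(x * length vs + y) div length vs = x"
    using assms by (intro div_nat_eqI) (simp_all add: mult.commute)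
  then show ?thesis using assms less by (simp add: graph_input_def Let_def)
qed

primrec store_vars :: "nat \<Rightarrow> prog" where
  "store_vars 0 = Skip"
| "store_vars (Suc m) = Seq (store_vars m) (Seq (Const 2 m) (Store 2 (var m)))"

lemma run_store_vars:
  "\<exists>s'. run (store_vars m) s (2 * m + 1) s' \<and> (\<forall>i<m. mem s' i = reg s (var i))
    \<and> (\<forall>i. reg s' (var i) = reg s (var i))"
proof (induction m)
  case 0
  show ?case using run.Skip[of s] by (intro exI[of _ s]) simp
next
  case (Suc m)
  then obtain s1 where s1: "run (store_vars m) s (2 * m + 1) s1" "\<forall>i<m. mem s1 i = reg s (var i)"
    "\<forall>i. reg s1 (var i) = reg s (var i)" by blast
  define s2 where "s2 = set_reg 2 m s1"
  define s3 where "s3 = s2\<lparr>mem := (mem s2)(m := reg s (var m))\<rparr>"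
  have "run (Store 2 (var m)) s2 1 s3"
    using run.Store[of 2 "var m" s2] s1(3) by (simp add: s2_def s3_def)
  moreover have "run (Const 2 m) s1 1 s2" unfolding s2_def by (rule run.Const)
  ultimately have "run (store_vars (Suc m)) s ((2 * m + 1) + (1 + 1)) s3"
    using s1(1) by (simp only: store_vars.simps) (intro run.Seq)
  moreover have "(2 * m + 1) + (1 + 1) = 2 * Suc m + 1" by simp
  ultimately have "run (store_vars (Suc m)) s (2 * Suc m + 1) s3" by (simp only:)
  moreover have "\<forall>i<Suc m. mem s3 i = reg s (var i)" "\<forall>i. reg s3 (var i) = reg s (var i)"
    using s1(2,3) by (auto simp: s2_def s3_def less_Suc_eq)
  ultimately show ?case by blast
qed

theorem proposition1p3:
  "\<exists>(P :: prog) (p :: nat poly). \<forall>(V :: nat set) (E :: nat set set) (vs :: nat list).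
     simple_graph V E \<and> planar V E \<and> girth V E \<ge> 8 \<and> distinct vs \<and> set vs = V \<longrightarrow>
     (\<exists>t s. run P (graph_input vs E) t s \<and> t \<le> poly p (card V)
        \<and> (card E \<ge> 3 \<longrightarrow>
             (\<exists>E'. edges_output vs s E' \<and> E' \<subseteq> E \<and> card E' = 3
                  \<and> domination_number V (E - E') > domination_number V E)))"
proof -
  let ?Q = "\<lambda>n M xs. cutting_triple n (\<lambda>x y. M (x * n + y) \<noteq> 0)
     (xs ! 0) (xs ! 1) (xs ! 2) (xs ! 3) (xs ! 4) (xs ! 5)"
  obtain P6 p6 where "searches 6 0 ?Q P6 p6"
    using decidable_cutting_triple unfolding decidable_def by (elim exE)
  \<comment> \<open>The six ends of the edges are searched for by one loop each, the last one innermost.\<close>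
  then have "searches (Suc (Suc (Suc (Suc (Suc (Suc 0)))))) 0 ?Q P6 p6" by (simp only: numeral_eq_Suc pred_numeral_simps One_nat_def BitM.simps)
  from searches_loop[OF searches_loop[OF searches_loop[OF searches_loop[OF searches_loop[OF searches_loop[OF this]]]]]]
  obtain P p where "searches 0 (Suc (Suc (Suc (Suc (Suc (Suc 0)))))) ?Q P p" by blast
  then have P: "searches 0 6 ?Q P p" by (simp add: eval_nat_numeral)
  let ?P = "Seq P (Seq (store_vars 6) (Const 0 3))" and ?p = "p + [:14:]"
  show ?thesis
  proof (rule exI[of _ ?P], rule exI[of _ ?p], intro allI impI, elim conjE)
    fix V :: "nat set" and E :: "nat set set" and vs :: "nat list"
    assume G: "simple_graph V E" and pl: "planar V E" and gi: "girth V E \<ge> 8"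
      and vs: "distinct vs" "set vs = V"
    let ?s = "graph_input vs E" and ?n = "length vs"
    have n: "reg ?s 0 = ?n" "card V = ?n"
      using vs distinct_card by (auto simp: graph_input_def Let_def)
    note A = mem_graph_input[where vs = vs and E = E]
    obtain t s1 where s1: "run P ?s t s1" "t \<le> poly p ?n"
      and res: "reg s1 1 = 1 \<and> set (vals 6 s1) \<subseteq> {..<?n} \<and> ?Q ?n (mem ?s) (vals 6 s1)
        \<or> reg s1 1 = 0 \<and> (\<forall>ys. length ys = 6 \<longrightarrow> set ys \<subseteq> {..<?n} \<longrightarrow> \<not> ?Q ?n (mem ?s) ys)"
      using P[unfolded searches_def, rule_format, of ?s] unfolding n by (auto simp: vals_def)
    obtain s2 where s2: "run (store_vars 6) s1 (2 * 6 + 1) s2" "\<forall>i<6. mem s2 i = reg s1 (var i)"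
      using run_store_vars[of 6 s1] by blast
    let ?s3 = "set_reg 0 3 s2"
    have run: "run ?P ?s (t + (2 * 6 + 1 + 1)) ?s3"
      by (intro run.Seq[OF s1(1)] run.Seq[OF s2(1)] run.Const)
    have "\<exists>E'. edges_output vs ?s3 E' \<and> E' \<subseteq> E \<and> card E' = 3
                  \<and> domination_number V (E - E') > domination_number V E" if E3: "card E \<ge> 3"
    proof -
      have finE: "finite E" and ne: "E \<noteq> {}" using E3 by (auto intro: card_ge_0_finite)
      have long: "8 \<le> length c" if "cycle_in E c" for c
        using order_trans[OF gi girth_le_length_cycle[OF G that]] by (simp add: numeral_eq_enat)
      obtain u v w where uvw: "u \<in> V" "v \<in> V" "w \<in> V" "near_pair E u v w"
        "card (edges_at E u) + card (edges_at E v) \<le> 4"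
        using near_pair_of_small_degree[OF G pl ne long] by metis
      obtain F where F: "F \<subseteq> E" "card F = 3" "cut_off V E F u v w"
        using cut_off_with_few_edges[OF finE uvw(4,5) E3] by metis
      have ends: "\<exists>x y. x < ?n \<and> y < ?n \<and> e = {vs ! x, vs ! y}" if "e \<in> F" for e
      proof -
        have "card e = 2" "e \<subseteq> set vs" using that F(1) G vs by (auto simp: simple_graph_def)
        then obtain p q where "e = {p, q}" "p \<in> set vs" "q \<in> set vs" by (auto simp: card_2_iff)
        then show ?thesis by (metis in_set_conv_nth)
      qed
      obtain e1 e2 e3 where F3: "F = {e1, e2, e3}" using F(2) by (auto simp: card_3_iff)
      obtain a b c d e f where less: "a < ?n" "b < ?n" "c < ?n" "d < ?n" "e < ?n" "f < ?n"
        and abc: "e1 = {vs ! a, vs ! b}" "e2 = {vs ! c, vs ! d}" "e3 = {vs ! e, vs ! f}"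
        using ends[of e1] ends[of e2] ends[of e3] F3 by auto
      have "cutting_triple ?n (\<lambda>x y. mem ?s (x * ?n + y) \<noteq> 0) a b c d e f"
        using cutting_triple_iff[OF vs refl A less F3[unfolded abc]] F uvw by blast
      then have "?Q ?n (mem ?s) [a, b, c, d, e, f]" by (simp add: eval_nat_numeral)
      then have found: "set (vals 6 s1) \<subseteq> {..<?n}" "?Q ?n (mem ?s) (vals 6 s1)"
        using res less by (auto dest: spec[of _ "[a, b, c, d, e, f]"])
      have small: "reg s1 (var i) < ?n" if "i < 6" for i
        using found(1) nth_mem[of i "vals 6 s1"] that by auto
      define F' where "F' = {{vs ! reg s1 (var 0), vs ! reg s1 (var 1)},
        {vs ! reg s1 (var 2), vs ! reg s1 (var 3)}, {vs ! reg s1 (var 4), vs ! reg s1 (var 5)}}"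
      have "cutting_triple ?n (\<lambda>x y. mem ?s (x * ?n + y) \<noteq> 0) (reg s1 (var 0)) (reg s1 (var 1))
        (reg s1 (var 2)) (reg s1 (var 3)) (reg s1 (var 4)) (reg s1 (var 5))"
        using found(2) nth_vals[of _ 6 s1] by simp
      moreover have "reg s1 (var 0) < ?n" "reg s1 (var 1) < ?n" "reg s1 (var 2) < ?n"
        "reg s1 (var 3) < ?n" "reg s1 (var 4) < ?n" "reg s1 (var 5) < ?n"
        by (rule small, simp)+
      ultimately have F': "F' \<subseteq> E" "card F' = 3"
        "\<exists>u\<in>V. \<exists>v\<in>V. \<exists>w\<in>V. near_pair E u v w \<and> cut_off V E F' u v w"
        using cutting_triple_iff[OF vs refl A _ _ _ _ _ _ F'_def] by blast+
      have "domination_number V E < domination_number V (E - F')"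
        using F'(3) cut_off_increases_domination[OF G] by blast
      moreover have "edges_output vs ?s3 F'"
      proof -
        have "mem ?s3 i < ?n" if "i < 6" for i using that s2(2) small by simp
        moreover have "{{vs ! mem ?s3 (2 * i), vs ! mem ?s3 (2 * i + 1)} |i. i < 3} = F'"
        proof -
          have "{i. i < 3} = {0, 1, 2 :: nat}" by auto
          then have "{{vs ! mem ?s3 (2 * i), vs ! mem ?s3 (2 * i + 1)} |i. i < 3}
            = (\<lambda>i. {vs ! mem ?s3 (2 * i), vs ! mem ?s3 (2 * i + 1)}) ` {0, 1, 2}"
            by blast
          also have "\<dots> = F'" using s2(2) by (simp add: F'_def)
          finally show ?thesis .
        qed
        ultimately show ?thesis by (simp add: edges_output_def)
      qed
      ultimately show ?thesis using F' by blast
    qed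
    moreover have "t + (2 * 6 + 1 + 1) \<le> poly ?p (card V)" using s1(2) n by simp
    ultimately show "\<exists>t s. run ?P ?s t s \<and> t \<le> poly ?p (card V)
        \<and> (card E \<ge> 3 \<longrightarrow> (\<exists>E'. edges_output vs s E' \<and> E' \<subseteq> E \<and> card E' = 3
                  \<and> domination_number V (E - E') > domination_number V E))"
      using run by blast
  qed
qed

end
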